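(* Let $K_{3,25}'$ denote the $1$-subdivision of the complete bipartite graph $K_{3,25}$. Then $\mathrm{ex}(n,K_{3,25}')=\Theta(n^{4/3})$; that is, there are constants $c,C>0$ such that $c\,n^{4/3}\le \mathrm{ex}(n,K_{3,25}')\le C\,n^{4/3}$ for all sufficiently large $n$.
   Context: For a graph $H$, the Turán number $\mathrm{ex}(n,H)$ is the maximum number of edges in an $n$-vertex (simple) graph that contains no subgraph isomorphic to $H$. The $1$-subdivision $H'$ of a graph $H$ is the graph obtained from $H$ by replacing each edge of $H$ by a path of length $2$, where the new middle vertices are distinct for distinct edges and are not vertices of $H$ (i.e. the edges are replaced by internally disjoint paths of length $2$). *)

theory Defs
  imports Complex_Main
begin

record 'a ugraph =
  verts :: "'a set"
  edges :: "'a set set"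

definition simple_graph :: "'a ugraph \<Rightarrow> bool" where
  "simple_graph G \<longleftrightarrow> finite (verts G) \<and> (\<forall>e\<in>edges G. e \<subseteq> verts G \<and> card e = 2)"

definition subgraph :: "'a ugraph \<Rightarrow> 'a ugraph \<Rightarrow> bool" where
  "subgraph S G \<longleftrightarrow>
     simple_graph S \<and> simple_graph G \<and> verts S \<subseteq> verts G \<and> edges S \<subseteq> edges G"

definition graph_iso :: "'a ugraph \<Rightarrow> 'b ugraph \<Rightarrow> bool" where
  "graph_iso G H \<longleftrightarrow>
     (\<exists>f. bij_betw f (verts G) (verts H) \<and>
          (\<forall>u\<in>verts G. \<forall>v\<in>verts G. {u, v} \<in> edges G \<longleftrightarrow> {f u, f v} \<in> edges H))"

definition contains_copy :: "'a ugraph \<Rightarrow> 'b ugraph \<Rightarrow> bool" where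
  "contains_copy G H \<longleftrightarrow> (\<exists>S. subgraph S G \<and> graph_iso H S)"

text \<open>Every finite graph is isomorphic to one whose vertices are natural numbers, so it is
  enough to let the host graph range over \<^typ>\<open>nat ugraph\<close>. The maximum exists as soon as the
  forbidden graph has an edge; see \<open>turan_set_finite\<close> and \<open>turan_set_nonempty\<close>.\<close>

definition turan_set :: "nat \<Rightarrow> 'b ugraph \<Rightarrow> nat set" where
  "turan_set n H =
     {card (edges G) | G :: nat ugraph.
        simple_graph G \<and> card (verts G) = n \<and> \<not> contains_copy G H}"

definition turan_number :: "nat \<Rightarrow> 'b ugraph \<Rightarrow> nat" where
  "turan_number n H = Max (turan_set n H)"

definition complete_bipartite :: "nat \<Rightarrow> nat \<Rightarrow> (nat + nat) ugraph" where
  "complete_bipartite s t =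
     \<lparr> verts = Inl ` {..<s} \<union> Inr ` {..<t},
       edges = {{Inl i, Inr j} | i j. i < s \<and> j < t} \<rparr>"

text \<open>The middle vertex of the path replacing the edge \<open>e\<close> is \<open>Inr e\<close>; it is joined to
  the two ends of \<open>e\<close>.\<close>

definition one_subdivision :: "'a ugraph \<Rightarrow> ('a + 'a set) ugraph" where
  "one_subdivision H =
     \<lparr> verts = Inl ` verts H \<union> Inr ` edges H,
       edges = {{Inl v, Inr e} | v e. e \<in> edges H \<and> v \<in> e} \<rparr>"

lemma simple_graph_finite_edges:
  assumes "simple_graph G"
  shows "finite (edges G)"
proof (rule finite_subset)
  show "edges G \<subseteq> Pow (verts G)" using assms by (auto simp: simple_graph_def)
  show "finite (Pow (verts G))" using assms by (auto simp: simple_graph_def)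
qed

lemma simple_graph_complete_bipartite: "simple_graph (complete_bipartite s t)"
  by (auto simp: simple_graph_def complete_bipartite_def)

lemma simple_graph_one_subdivision:
  assumes "simple_graph H"
  shows "simple_graph (one_subdivision H)"
  using assms simple_graph_finite_edges[OF assms]
  by (auto simp: simple_graph_def one_subdivision_def)

lemma turan_set_finite: "finite (turan_set n H)"
proof (rule finite_subset)
  show "turan_set n H \<subseteq> {..2 ^ n}"
  proof
    fix k assume "k \<in> turan_set n H"
    then obtain G :: "nat ugraph"
      where G: "k = card (edges G)" "simple_graph G" "card (verts G) = n"
      by (auto simp: turan_set_def)
    have "card (edges G) \<le> card (Pow (verts G))"
      by (rule card_mono) (use G(2) in \<open>auto simp: simple_graph_def\<close>)
    with G show "k \<in> {..2 ^ n}" by (simp add: card_Pow simple_graph_def)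
  qed
qed simp

lemma turan_set_nonempty:
  assumes "simple_graph H" "edges H \<noteq> {}"
  shows "turan_set n H \<noteq> {}"
proof -
  define G :: "nat ugraph" where "G = \<lparr> verts = {..<n}, edges = {} \<rparr>"
  obtain e where e: "e \<in> edges H" using assms(2) by blast
  then obtain u v where uv: "e = {u, v}" "u \<in> verts H" "v \<in> verts H"
    using assms(1) by (auto simp: simple_graph_def card_2_iff)
  have "\<not> contains_copy G H"
    using e uv by (auto simp: contains_copy_def subgraph_def graph_iso_def G_def)
  moreover have "simple_graph G" "card (verts G) = n"
    by (auto simp: G_def simple_graph_def)
  ultimately show ?thesis unfolding turan_set_def by blast
qed

end

theory Submission
  imports Defs "HOL-Algebra.Algebraic_Closure_Type" "HOL-Analysis.Convex"
begin

text \<open>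
  Lower bound. Let \<open>F\<close> be the field with \<open>q = 3 ^ k\<close> elements and \<open>S\<close> the set of its elements of trace
  one. Join \<open>(a, b, c)\<close> and \<open>(s, d, e)\<close>, both in \<open>S \<times> F \<times> F\<close>, if \<open>b + d = a\<^sup>2 s\<close> and \<open>c + e = a s\<^sup>2\<close>; this
  bipartite graph has order \<open>q\<^sup>3\<close> vertices and \<open>q\<^sup>4\<close> edges, and exchanging the last two coordinates swaps
  its sides. A vertex \<open>(p, U, V)\<close> at distance two from \<open>(a\<^sub>i, b\<^sub>i, c\<^sub>i)\<close> satisfies
  \<open>(U - b\<^sub>i)\<^sup>2 = (p - a\<^sub>i) (p + a\<^sub>i)\<^sup>2 (V - c\<^sub>i)\<close>. For three given vertices, elimination leaves a nonzero
  polynomial of degree at most 12 in \<open>p\<close>, and every \<open>p\<close> admits at most two pairs \<open>(U, V)\<close>; so there are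
  at most 24 solutions, apart from those where the three paths share their middle vertex.

  Upper bound. Pass to a bipartite subgraph with sides \<open>A\<close>, \<open>B\<close> and let \<open>|A| \<le> n\<close>. It suffices to show
  that \<open>O((n / D)\<^bsup>3/2\<^esup>)\<close> vertices of \<open>B\<close> have degree at least \<open>D\<close> whenever \<open>D\<^sup>3 \<ge> n\<close>; trim their degrees to
  exactly \<open>D\<close>. Pairs in \<open>A\<close> with at least 75 common neighbours contain no \<open>K\<^bsub>3,25\<^esub>\<close>, so most pairs inside a
  neighbourhood are light. Count stars consisting of a centre \<open>v\<close> joined by light pairs with distinct
  middle vertices to \<open>u1\<close>, \<open>u2\<close>, \<open>u3\<close>. If a triple has many centres, then by freeness a positive proportion of
  them uses the same middle vertex \<open>w\<close> towards the same \<open>u\<^sub>i\<close>, hence lies in \<open>N w\<close> and forms many light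
  pairs. For given \<open>u2\<close>, \<open>u3\<close> with \<open>m\<close> common light neighbours there are at most \<open>74 D m\<^sup>2\<close> such clashes over
  all \<open>u1\<close>, and Cauchy-Schwarz bounds the number of stars.
\<close>

section \<open>Copies of a subdivided complete bipartite graph\<close>

text \<open>\<open>x\<close> and \<open>u\<close> list the branch vertices of the two sides, and
  \<open>y i j\<close> is the middle vertex between \<open>x i\<close> and \<open>u j\<close>. Only
  an edge set occurs, so that copies can be moved between graphs on different types.\<close>

definition subdivided_biclique ::
  "nat \<Rightarrow> nat \<Rightarrow> 'a set set \<Rightarrow> (nat \<Rightarrow> 'a) \<Rightarrow> (nat \<Rightarrow> 'a) \<Rightarrow> (nat \<Rightarrow> nat \<Rightarrow> 'a) \<Rightarrow> bool" where
  "subdivided_biclique s t E x u y \<longleftrightarrow>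
     inj_on x {..<s} \<and> inj_on u {..<t} \<and> inj_on (\<lambda>(i, j). y i j) ({..<s} \<times> {..<t}) \<and>
     (\<forall>i<s. \<forall>j<t. x i \<noteq> u j) \<and>
     (\<forall>k<s. \<forall>i<s. \<forall>j<t. x k \<noteq> y i j) \<and>
     (\<forall>k<t. \<forall>i<s. \<forall>j<t. u k \<noteq> y i j) \<and>
     (\<forall>i<s. \<forall>j<t. {x i, y i j} \<in> E \<and> {u j, y i j} \<in> E)"

text \<open>Copies need not be induced: \<open>S\<close> may be taken to be the image of
  \<open>H\<close> with exactly the images of its edges, and then the equivalence demanded by
  \<open>graph_iso\<close> follows from injectivity.\<close>

lemma contains_copy_iff_embedding:
  assumes "simple_graph G" "simple_graph H"
  shows "contains_copy G H \<longleftrightarrow>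
    (\<exists>f. inj_on f (verts H) \<and> f ` verts H \<subseteq> verts G \<and> (\<forall>e\<in>edges H. f ` e \<in> edges G))"
    (is "_ \<longleftrightarrow> (\<exists>f. ?emb f)")
proof
  assume "contains_copy G H"
  then obtain S f where S: "subgraph S G" and f: "bij_betw f (verts H) (verts S)"
    and fe: "\<forall>u\<in>verts H. \<forall>v\<in>verts H. {u, v} \<in> edges H \<longleftrightarrow> {f u, f v} \<in> edges S"
    unfolding contains_copy_def graph_iso_def by blast
  have "f ` e \<in> edges G" if e: "e \<in> edges H" for e
  proof -
    obtain u v where "e = {u, v}" "u \<in> verts H" "v \<in> verts H"
      using assms(2) e by (auto simp: simple_graph_def card_2_iff)
    with fe e S show ?thesis by (auto simp: subgraph_def)
  qed
  then have "?emb f" using f S by (auto simp: subgraph_def bij_betw_def)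
  then show "\<exists>f. ?emb f" by blast
next
  assume "\<exists>f. ?emb f"
  then obtain f where f: "?emb f" by blast
  define S where "S = \<lparr> verts = f ` verts H, edges = (`) f ` edges H \<rparr>"
  have inj: "inj_on f (verts H)" using f by blast
  have "simple_graph S"
    unfolding simple_graph_def S_def
    using assms(2) inj
    by (auto simp: simple_graph_def card_image inj_on_subset)
  then have "subgraph S G" using f assms by (auto simp: subgraph_def S_def)
  moreover have "graph_iso H S"
    unfolding graph_iso_def
  proof (intro exI conjI ballI)
    show "bij_betw f (verts H) (verts S)" using inj by (auto simp: bij_betw_def S_def)
    fix u v assume uv: "u \<in> verts H" "v \<in> verts H"
    show "({u, v} \<in> edges H) = ({f u, f v} \<in> edges S)"
    proof
      assume "{u, v} \<in> edges H"
      then have "f ` {u, v} \<in> (`) f ` edges H" by (rule imageI)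
      then show "{f u, f v} \<in> edges S" by (simp add: S_def)
    next
      assume "{f u, f v} \<in> edges S"
      then obtain e where e: "e \<in> edges H" "f ` {u, v} = f ` e"
        by (auto simp add: S_def)
      have "{u, v} = e"
        using inj_on_image_eq_iff[OF inj, of "{u, v}" e] e uv assms(2)
        unfolding simple_graph_def by blast
      with e show "{u, v} \<in> edges H" by simp
    qed
  qed
  ultimately show "contains_copy G H" unfolding contains_copy_def by blast
qed

lemma contains_subdivided_biclique_iff:
  assumes G: "simple_graph G" and "s > 0" "t > 0"
  shows "contains_copy G (one_subdivision (complete_bipartite s t)) \<longleftrightarrow>
    (\<exists>x u y. subdivided_biclique s t (edges G) x u y)"
proof -
  let ?H = "one_subdivision (complete_bipartite s t)"
  have H: "simple_graph ?H"
    by (intro simple_graph_one_subdivision simple_graph_complete_bipartite)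
  have vH: "verts ?H = (\<lambda>i. Inl (Inl i)) ` {..<s} \<union> (\<lambda>j. Inl (Inr j)) ` {..<t} \<union>
      (\<lambda>(i, j). Inr {Inl i, Inr j}) ` ({..<s} \<times> {..<t})"
    by (auto simp: one_subdivision_def complete_bipartite_def)
  have eH: "edges ?H = (\<Union>i<s. \<Union>j<t. {{Inl (Inl i), Inr {Inl i, Inr j}}, {Inl (Inr j), Inr {Inl i, Inr j}}})"
    (is "_ = ?R")
  proof -
    have "edges ?H = (\<Union>e \<in> edges (complete_bipartite s t). (\<lambda>v. {Inl v, Inr e}) ` e)"
      unfolding one_subdivision_def by auto
    also have "edges (complete_bipartite s t) = (\<Union>i<s. \<Union>j<t. {{Inl i, Inr j}})"
      unfolding complete_bipartite_def by auto
    finally show ?thesis by simp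
  qed
  show ?thesis
  proof
    assume "contains_copy G ?H"
    then obtain f where f: "inj_on f (verts ?H)" "\<forall>e\<in>edges ?H. f ` e \<in> edges G"
      using contains_copy_iff_embedding[OF G H] by blast
    define x where "x = (\<lambda>i. f (Inl (Inl i)))"
    define u where "u = (\<lambda>j. f (Inl (Inr j)))"
    define y where "y = (\<lambda>i j. f (Inr {Inl i, Inr j}))"
    have fi: "f a = f b \<longleftrightarrow> a = b" if "a \<in> verts ?H" "b \<in> verts ?H" for a b
      using f(1) that by (auto simp: inj_on_def)
    have m: "Inl (Inl i) \<in> verts ?H" "Inl (Inr j) \<in> verts ?H" "Inr {Inl i, Inr j} \<in> verts ?H"
      if "i < s" "j < t" for i j
      using that unfolding vH by auto
    have m1: "Inl (Inl i) \<in> verts ?H" if "i < s" for i using m that assms by blast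
    have m2: "Inl (Inr j) \<in> verts ?H" if "j < t" for j using m that assms by blast
    have "subdivided_biclique s t (edges G) x u y"
      unfolding subdivided_biclique_def x_def u_def y_def
    proof (intro conjI)
      show "inj_on (\<lambda>i. f (Inl (Inl i))) {..<s}" by (auto simp: inj_on_def fi m1)
      show "inj_on (\<lambda>j. f (Inl (Inr j))) {..<t}" by (auto simp: inj_on_def fi m2)
      show "inj_on (\<lambda>(i, j). f (Inr {Inl i, Inr j})) ({..<s} \<times> {..<t})"
        by (auto simp: inj_on_def fi m doubleton_eq_iff)
      show "\<forall>i<s. \<forall>j<t. {f (Inl (Inl i)), f (Inr {Inl i, Inr j})} \<in> edges G \<and>
          {f (Inl (Inr j)), f (Inr {Inl i, Inr j})} \<in> edges G"
      proof (intro allI impI)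
        fix i j assume ij: "i < s" "j < t"
        have "{Inl (Inl i), Inr {Inl i, Inr j}} \<in> edges ?H" "{Inl (Inr j), Inr {Inl i, Inr j}} \<in> edges ?H"
          unfolding eH using ij by blast+
        from this[THEN f(2)[rule_format]]
        show "{f (Inl (Inl i)), f (Inr {Inl i, Inr j})} \<in> edges G \<and>
          {f (Inl (Inr j)), f (Inr {Inl i, Inr j})} \<in> edges G" by simp
      qed
    qed (auto simp: fi m m1 m2)
    then show "\<exists>x u y. subdivided_biclique s t (edges G) x u y" by blast
  next
    assume "\<exists>x u y. subdivided_biclique s t (edges G) x u y"
    then obtain x u y where "subdivided_biclique s t (edges G) x u y" by blast
    then have inj: "inj_on x {..<s}" "inj_on u {..<t}" "inj_on (\<lambda>(i, j). y i j) ({..<s} \<times> {..<t})"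
      and d: "\<forall>i<s. \<forall>j<t. x i \<noteq> u j" "\<forall>k<s. \<forall>i<s. \<forall>j<t. x k \<noteq> y i j"
        "\<forall>k<t. \<forall>i<s. \<forall>j<t. u k \<noteq> y i j"
      and e: "\<forall>i<s. \<forall>j<t. {x i, y i j} \<in> edges G \<and> {u j, y i j} \<in> edges G"
      unfolding subdivided_biclique_def by blast+
    \<comment> \<open>A middle vertex is a two-element set holding one index of each kind;
      \<open>THE\<close> reads the two indices off again.\<close>
    define f where "f = case_sum (case_sum x u)
      (\<lambda>e. y (THE i. Inl i \<in> e) (THE j. Inr j \<in> e))"
    have fs [simp]: "f (Inl (Inl i)) = x i" "f (Inl (Inr j)) = u j"
      "f (Inr {Inl i, Inr j}) = y i j" for i j
      by (auto simp: f_def)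
    have "inj_on f (verts ?H)"
      unfolding vH
    proof (intro inj_on_Un[THEN iffD2] conjI)
      show "inj_on f ((\<lambda>i. Inl (Inl i)) ` {..<s})" using inj(1) by (auto simp: inj_on_def)
      show "inj_on f ((\<lambda>j. Inl (Inr j)) ` {..<t})" using inj(2) by (auto simp: inj_on_def)
      show "inj_on f ((\<lambda>(i, j). Inr {Inl i, Inr j}) ` ({..<s} \<times> {..<t}))"
        using inj(3) unfolding inj_on_def by auto
      show "f ` ((\<lambda>i. Inl (Inl i)) ` {..<s} - (\<lambda>j. Inl (Inr j)) ` {..<t}) \<inter>
          f ` ((\<lambda>j. Inl (Inr j)) ` {..<t} - (\<lambda>i. Inl (Inl i)) ` {..<s}) = {}"
        using d(1) by auto
      show "f ` ((\<lambda>i. Inl (Inl i)) ` {..<s} \<union> (\<lambda>j. Inl (Inr j)) ` {..<t} -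
            (\<lambda>(i, j). Inr {Inl i, Inr j}) ` ({..<s} \<times> {..<t})) \<inter>
          f ` ((\<lambda>(i, j). Inr {Inl i, Inr j}) ` ({..<s} \<times> {..<t}) -
            ((\<lambda>i. Inl (Inl i)) ` {..<s} \<union> (\<lambda>j. Inl (Inr j)) ` {..<t})) = {}"
        using d(2,3) by auto
    qed
    moreover have "f ` e' \<in> edges G" if "e' \<in> edges ?H" for e'
      using that e unfolding eH by auto
    moreover have "f ` verts ?H \<subseteq> verts G"
    proof -
      have sub: "a \<in> verts G" "b \<in> verts G" if "{a, b} \<in> edges G" for a b
        using G that unfolding simple_graph_def by auto
      have xG: "x i \<in> verts G" if "i < s" for i using e that sub assms by blast
      have uG: "u i \<in> verts G" if "i < t" for i using e that sub assms by blast
      have yG: "y i j \<in> verts G" if "i < s" "j < t" for i j using e that sub by blast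
      show ?thesis unfolding vH using xG uG yG by auto
    qed
    ultimately show "contains_copy G ?H" using contains_copy_iff_embedding[OF G H] by blast
  qed
qed

text \<open>Positive \<open>s\<close> and \<open>t\<close> make every branch vertex an end of some
  edge, so all vertices of the copy are among those on which \<open>g\<close> is injective.\<close>

lemma subdivided_biclique_map:
  assumes "subdivided_biclique s t E x u y" "inj_on g (\<Union>E)" "s > 0" "t > 0"
  shows "subdivided_biclique s t ((`) g ` E) (g \<circ> x) (g \<circ> u) (\<lambda>i j. g (y i j))"
proof -
  note c = assms(1)[unfolded subdivided_biclique_def]
  have e: "{x i, y i j} \<in> E" "{u j, y i j} \<in> E" if "i < s" "j < t" for i j
    using c that by blast+
  have yE: "y i j \<in> \<Union>E" if "i < s" "j < t" for i j using e(1)[OF that] by blast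
  have xE: "x i \<in> \<Union>E" if "i < s" for i using e(1)[OF that assms(4)] by blast
  have uE: "u j \<in> \<Union>E" if "j < t" for j using e(2)[OF assms(3) that] by blast
  have gi: "g a = g b \<longleftrightarrow> a = b" if "a \<in> \<Union>E" "b \<in> \<Union>E" for a b
    using assms(2) that by (auto simp: inj_on_def)
  show ?thesis unfolding subdivided_biclique_def
  proof (intro conjI)
    show "inj_on (g \<circ> x) {..<s}" using c by (auto simp: inj_on_def gi xE simp del: Union_iff)
    show "inj_on (g \<circ> u) {..<t}" using c by (auto simp: inj_on_def gi uE simp del: Union_iff)
    show "inj_on (\<lambda>(i, j). g (y i j)) ({..<s} \<times> {..<t})"
      using c by (auto simp: inj_on_def gi yE simp del: Union_iff)
    show "\<forall>i<s. \<forall>j<t. {(g \<circ> x) i, g (y i j)} \<in> (`) g ` E \<and> {(g \<circ> u) j, g (y i j)} \<in> (`) g ` E"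
    proof (intro allI impI conjI)
      fix i j assume "i < s" "j < t"
      note e[OF this, THEN imageI[of _ _ "(`) g"]]
      then show "{(g \<circ> x) i, g (y i j)} \<in> (`) g ` E" "{(g \<circ> u) j, g (y i j)} \<in> (`) g ` E" by auto
    qed
  qed (use c in \<open>auto simp: gi xE uE yE simp del: Union_iff\<close>)
qed

text \<open>Lets a construction live on any type: its vertices are renamed by natural numbers,
  isolated vertices fill the graph up to order \<open>n\<close>, and the inverse renaming would
  carry a copy back.\<close>

lemma card_edges_le_turan_number:
  assumes "finite E" "\<And>e. e \<in> E \<Longrightarrow> card e = 2" "card (\<Union>E) \<le> n" "s > 0" "t > 0"
    and free: "\<And>x u y. \<not> subdivided_biclique s t E x u y"
  shows "card E \<le> turan_number n (one_subdivision (complete_bipartite s t))"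
proof -
  have "finite e" if "e \<in> E" for e using assms(2)[OF that] by (simp add: card_ge_0_finite)
  then have fin: "finite (\<Union>E)" using assms(1) by blast
  then obtain h where h: "bij_betw h (\<Union>E) {..<card (\<Union>E)}"
    using ex_bij_betw_finite_nat[OF fin] by (auto simp: lessThan_atLeast0)
  then have inj: "inj_on h (\<Union>E)" by (simp add: bij_betw_def)
  define G where "G = \<lparr> verts = {..<n}, edges = (`) h ` E \<rparr>"
  have "simple_graph G" unfolding simple_graph_def G_def
  proof (simp, intro ballI conjI)
    fix e assume e: "e \<in> E"
    have "h ` \<Union>E \<subseteq> {..<n}" using h assms(3) by (auto simp: bij_betw_def)
    then show "h ` e \<subseteq> {..<n}" using e by blast
    show "card (h ` e) = 2"
      using card_image[OF inj_on_subset[OF inj], of e] e assms(2) by auto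
  qed
  moreover have "card (verts G) = n" by (simp add: G_def)
  moreover have "\<not> contains_copy G (one_subdivision (complete_bipartite s t))"
  proof
    assume "contains_copy G (one_subdivision (complete_bipartite s t))"
    then obtain x u y where c: "subdivided_biclique s t ((`) h ` E) x u y"
      using contains_subdivided_biclique_iff[OF \<open>simple_graph G\<close> assms(4,5)] by (auto simp: G_def)
    define g where "g = the_inv_into (\<Union>E) h"
    have gh: "g (h v) = v" if "v \<in> \<Union>E" for v
      using the_inv_into_f_f[OF inj that] by (simp add: g_def)
    have U: "\<Union>((`) h ` E) = h ` \<Union>E" by blast
    have "inj_on g (\<Union>((`) h ` E))" unfolding U g_def by (rule inj_on_the_inv_into[OF inj])
    from subdivided_biclique_map[OF c this assms(4,5)]
    have "subdivided_biclique s t ((`) g ` (`) h ` E) (g \<circ> x) (g \<circ> u) (\<lambda>i j. g (y i j))" .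
    moreover have "(`) g ` (`) h ` E = E"
    proof -
      have "g ` h ` e = e" if "e \<in> E" for e
      proof -
        have "g (h v) = v" if "v \<in> e" for v using gh that \<open>e \<in> E\<close> by blast
        then show ?thesis by (simp add: image_image)
      qed
      then show ?thesis by (simp add: image_image)
    qed
    ultimately show False using free by metis
  qed
  moreover have "card (edges G) = card E"
  proof -
    have "inj_on ((`) h) E" by (rule inj_onI) (simp add: inj_on_image_eq_iff[OF inj] Union_upper)
    then show ?thesis by (simp add: G_def card_image)
  qed
  ultimately have "card E \<in> turan_set n (one_subdivision (complete_bipartite s t))"
    unfolding turan_set_def by (intro CollectI exI[of _ G]) simp
  then show ?thesis unfolding turan_number_def by (intro Max_ge turan_set_finite)
qed

section \<open>Elimination\<close>

text \<open>All cases of the elimination end here: at most 12 values of the first coordinate and at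
  most two points over each.\<close>

lemma card_le_of_poly_fibres:
  fixes A :: "('a::idom \<times> 'b) set" and P :: "'a poly"
  assumes "P \<noteq> 0" "degree P \<le> 12" "\<And>u. u \<in> A \<Longrightarrow> poly P (fst u) = 0"
    and fib: "\<And>p. finite {u \<in> A. fst u = p} \<and> card {u \<in> A. fst u = p} \<le> 2"
  shows "finite A \<and> card A \<le> 24"
proof -
  define R where "R = {p. poly P p = 0}"
  have R: "finite R" "card R \<le> 12"
    using poly_roots_finite[OF assms(1)] card_poly_roots_bound[OF assms(1)] assms(2)
    by (auto simp: R_def)
  have A: "A = (\<Union>p\<in>R. {u \<in> A. fst u = p})" using assms(3) by (auto simp: R_def)
  have "card (\<Union>p\<in>R. {u \<in> A. fst u = p}) \<le> (\<Sum>p\<in>R. card {u \<in> A. fst u = p})"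
    by (rule card_UN_le[OF R(1)])
  also have "\<dots> \<le> of_nat (card R) * 2" by (rule sum_bounded_above) (use fib in auto)
  also have "\<dots> \<le> 24" using R(2) by simp
  finally have "card A \<le> 24" using A by simp
  moreover have "finite (\<Union>p\<in>R. {u \<in> A. fst u = p})" using R(1) fib by auto
  ultimately show ?thesis using A by simp
qed

text \<open>Eliminating \<open>V\<close> leaves a quadratic in \<open>U\<close> with leading
  coefficient \<open>q2 - q1\<close>, and \<open>q1 \<noteq> 0\<close> recovers \<open>V\<close>
  from \<open>U\<close>.\<close>

lemma card_parabola_Int_le:
  fixes q1 q2 :: "'a::field"
  assumes "q1 \<noteq> q2" "q1 \<noteq> 0"
    and sub: "\<And>U V. (U, V) \<in> A \<Longrightarrow> (U - b1)\<^sup>2 = q1 * (V - c1) \<and> (U - b2)\<^sup>2 = q2 * (V - c2)"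
  shows "finite A \<and> card A \<le> 2"
proof -
  define P where "P = [:q2 * b1\<^sup>2 - q1 * b2\<^sup>2 + q1 * q2 * (c1 - c2), - 2 * (q2 * b1 - q1 * b2), q2 - q1:]"
  have "P \<noteq> 0" using assms(1) by (simp add: P_def)
  have "degree P \<le> 2" by (simp add: P_def)
  have root: "poly P U = 0" if "(U, V) \<in> A" for U V
  proof -
    have "poly P U = q2 * (U - b1)\<^sup>2 - q1 * (U - b2)\<^sup>2 + q1 * q2 * (c1 - c2)"
      by (simp add: P_def algebra_simps power2_eq_square)
    also have "\<dots> = 0" using conjunct1[OF sub[OF that]] conjunct2[OF sub[OF that]] by Groebner_Basis.algebra
    finally show ?thesis .
  qed
  have inj: "inj_on fst A"
  proof (rule inj_onI)
    fix u v assume uv: "u \<in> A" "v \<in> A" "fst u = fst v"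
    have "(fst u, snd u) \<in> A" using uv(1) by simp
    moreover have "(fst u, snd v) \<in> A" unfolding uv(3) using uv(2) by simp
    ultimately have "q1 * (snd u - c1) = q1 * (snd v - c1)" using sub by metis
    then show "u = v" using uv(3) assms(2) by (simp add: prod_eq_iff)
  qed
  have sub': "fst ` A \<subseteq> {U. poly P U = 0}" using root by auto
  have "finite (fst ` A)" by (rule finite_subset[OF sub' poly_roots_finite[OF \<open>P \<noteq> 0\<close>]])
  moreover have "card (fst ` A) \<le> 2"
    using card_mono[OF poly_roots_finite[OF \<open>P \<noteq> 0\<close>] sub'] card_poly_roots_bound[OF \<open>P \<noteq> 0\<close>]
      \<open>degree P \<le> 2\<close> by linarith
  ultimately show ?thesis using inj by (simp add: finite_image_iff card_image)
qed

section \<open>Cubics in the first coordinate and their eliminant\<close>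

definition cone_poly :: "'a::field \<Rightarrow> 'a poly" where
  "cone_poly a = [:- (a ^ 3), - (a\<^sup>2), a, 1:]"

lemma poly_cone_poly [simp]: "poly (cone_poly a) p = (p - a) * (p + a)\<^sup>2"
  by (simp add: cone_poly_def algebra_simps power2_eq_square power3_eq_cube)

lemma degree_cone_poly: "degree (cone_poly a) \<le> 3"
  by (simp add: cone_poly_def)

text \<open>Subtracting the equations \<open>(U - b\<^sub>i)\<^sup>2 = q\<^sub>i * (V - c\<^sub>i)\<close> from each other gives two linear
  equations in \<open>U\<close> and \<open>V\<close>; solving them by Cramer's rule (\<open>D * U = M\<close>, \<open>D * V = N\<close>) and substituting
  into the first equation, multiplied by \<open>D\<^sup>2\<close>, eliminates \<open>U\<close> and \<open>V\<close>.\<close>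

definition eliminant :: "'a::idom \<Rightarrow> 'a \<Rightarrow> 'a \<Rightarrow> 'a \<Rightarrow> 'a \<Rightarrow> 'a \<Rightarrow> 'a \<Rightarrow> 'a \<Rightarrow> 'a \<Rightarrow> 'a" where
  "eliminant b1 c1 b2 c2 b3 c3 q1 q2 q3 =
    (let e2 = b1\<^sup>2 - b2\<^sup>2 + q1 * c1 - q2 * c2;
         e3 = b1\<^sup>2 - b3\<^sup>2 + q1 * c1 - q3 * c3;
         D = 2 * (b1 - b2) * (q1 - q3) - 2 * (b1 - b3) * (q1 - q2);
         M = (q1 - q3) * e2 - (q1 - q2) * e3;
         N = 2 * (b1 - b2) * e3 - 2 * (b1 - b3) * e2
     in (M - b1 * D)\<^sup>2 - q1 * (N - c1 * D) * D)"

lemma eliminant_eq_0: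
  fixes U V :: "'a::idom"
  assumes "(U - b1)\<^sup>2 = q1 * (V - c1)" "(U - b2)\<^sup>2 = q2 * (V - c2)" "(U - b3)\<^sup>2 = q3 * (V - c3)"
  shows "eliminant b1 c1 b2 c2 b3 c3 q1 q2 q3 = 0"
proof -
  define e2 e3 D M N where defs: "e2 = b1\<^sup>2 - b2\<^sup>2 + q1 * c1 - q2 * c2"
    "e3 = b1\<^sup>2 - b3\<^sup>2 + q1 * c1 - q3 * c3"
    "D = 2 * (b1 - b2) * (q1 - q3) - 2 * (b1 - b3) * (q1 - q2)"
    "M = (q1 - q3) * e2 - (q1 - q2) * e3"
    "N = 2 * (b1 - b2) * e3 - 2 * (b1 - b3) * e2"
  have l: "e2 = 2 * (b1 - b2) * U + (q1 - q2) * V" "e3 = 2 * (b1 - b3) * U + (q1 - q3) * V"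
    using assms unfolding defs by Groebner_Basis.algebra+
  have "M = D * U" "N = D * V"
    unfolding defs(3-5) l by (simp_all add: algebra_simps)
  then have "(M - b1 * D)\<^sup>2 - q1 * (N - c1 * D) * D = D\<^sup>2 * ((U - b1)\<^sup>2 - q1 * (V - c1))"
    by (simp add: algebra_simps power2_eq_square)
  also have "\<dots> = 0" using assms(1) by simp
  finally show ?thesis unfolding eliminant_def defs Let_def .
qed

text \<open>At a zero of one of the cubics the eliminant is a perfect square, so its vanishing there
  yields an equation of half the degree. For \<open>q1 = 0\<close> only the square in the definition
  survives; for \<open>q2 = 0\<close> the second vertex can take over the role of the first.\<close>

lemma eliminant_at_0:
  fixes b1 :: "'a::idom"
  shows "eliminant b1 c1 b2 c2 b3 c3 0 q2 q3 =
      (q2 * q3 * (c2 - c3) + q3 * (b1 - b2)\<^sup>2 - q2 * (b1 - b3)\<^sup>2)\<^sup>2"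
    and "eliminant b1 c1 b2 c2 b3 c3 q1 0 q3 =
      (q1 * q3 * (c1 - c3) + q3 * (b2 - b1)\<^sup>2 - q1 * (b2 - b3)\<^sup>2)\<^sup>2"
proof -
  show "eliminant b1 c1 b2 c2 b3 c3 0 q2 q3 =
      (q2 * q3 * (c2 - c3) + q3 * (b1 - b2)\<^sup>2 - q2 * (b1 - b3)\<^sup>2)\<^sup>2"
    unfolding eliminant_def Let_def mult_zero_left diff_zero
    by (rule arg_cong[where f = "\<lambda>x. x\<^sup>2"]) (simp add: algebra_simps power2_eq_square)
  define e2 e3 D M N where defs: "e2 = b1\<^sup>2 - b2\<^sup>2 + q1 * c1 - 0 * c2"
    "e3 = b1\<^sup>2 - b3\<^sup>2 + q1 * c1 - q3 * c3"
    "D = 2 * (b1 - b2) * (q1 - q3) - 2 * (b1 - b3) * (q1 - 0)"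
    "M = (q1 - q3) * e2 - (q1 - 0) * e3"
    "N = 2 * (b1 - b2) * e3 - 2 * (b1 - b3) * e2"
  have "eliminant b1 c1 b2 c2 b3 c3 q1 0 q3 = (M - b1 * D)\<^sup>2 - q1 * (N - c1 * D) * D"
    unfolding eliminant_def Let_def defs ..
  \<comment> \<open>This is the difference of the first two equations, multiplied by
    \<open>D\<close>, with \<open>M\<close> and \<open>N\<close> for \<open>D * U\<close> and
    \<open>D * V\<close>.\<close>
  moreover have "2 * (b1 - b2) * M + q1 * N = e2 * D"
    unfolding defs(3-5) by (simp add: algebra_simps)
  then have "(M - b1 * D)\<^sup>2 - q1 * (N - c1 * D) * D = (M - b2 * D)\<^sup>2"
    unfolding defs(1) by Groebner_Basis.algebra
  moreover have "M - b2 * D = - (q1 * q3 * (c1 - c3) + q3 * (b2 - b1)\<^sup>2 - q1 * (b2 - b3)\<^sup>2)"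
    unfolding defs by (simp add: algebra_simps power2_eq_square)
  ultimately show "eliminant b1 c1 b2 c2 b3 c3 q1 0 q3 =
      (q1 * q3 * (c1 - c3) + q3 * (b2 - b1)\<^sup>2 - q1 * (b2 - b3)\<^sup>2)\<^sup>2"
    by (simp only: power2_minus)
qed


text \<open>With \<open>q = (z - a) * (z + a)\<^sup>2\<close> one has
  \<open>(z\<^sup>2 - a\<^sup>2)\<^sup>2 = q * (z - a)\<close>, so both cubics divide the vanishing
  expression and can be cancelled.\<close>

lemma eliminant_zero_imp:
  fixes z :: "'a::field"
  assumes "b1 - b2 = s3 * (z\<^sup>2 - a2\<^sup>2)" "b1 - b3 = s2 * (z\<^sup>2 - a3\<^sup>2)" "z\<^sup>2 \<noteq> a2\<^sup>2" "z\<^sup>2 \<noteq> a3\<^sup>2"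
    and "((z - a2) * (z + a2)\<^sup>2) * ((z - a3) * (z + a3)\<^sup>2) * (c2 - c3) +
      ((z - a3) * (z + a3)\<^sup>2) * (b1 - b2)\<^sup>2 - ((z - a2) * (z + a2)\<^sup>2) * (b1 - b3)\<^sup>2 = 0"
  shows "c2 - c3 + s3\<^sup>2 * (z - a2) - s2\<^sup>2 * (z - a3) = 0"
proof -
  have "((z - a2) * (z + a2)\<^sup>2) * ((z - a3) * (z + a3)\<^sup>2) *
      (c2 - c3 + s3\<^sup>2 * (z - a2) - s2\<^sup>2 * (z - a3)) = 0"
    using assms(5) unfolding assms(1,2) by Groebner_Basis.algebra
  moreover have "z - a2 \<noteq> 0" "z + a2 \<noteq> 0" "z - a3 \<noteq> 0" "z + a3 \<noteq> 0"
    using assms(3,4) by (auto simp: eq_neg_iff_add_eq_0[symmetric])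
  ultimately show ?thesis by simp
qed


text \<open>The vertices \<open>(p, U, V)\<close> and \<open>(a, b, c)\<close> have a common neighbour with first coordinate \<open>s\<close>
  in the graph defined by \<open>incident\<close> below.\<close>

definition common_solution ::
  "'a::field \<times> 'a \<times> 'a \<Rightarrow> 'a \<times> 'a \<times> 'a \<Rightarrow> 'a \<Rightarrow> bool" where
  "common_solution = (\<lambda>(p, U, V) (a, b, c) s.
     p\<^sup>2 \<noteq> a\<^sup>2 \<and> U - b = (p\<^sup>2 - a\<^sup>2) * s \<and> V - c = (p - a) * s\<^sup>2)"

lemma common_solution_cone:
  assumes "common_solution (p, U, V) (a, b, c) s"
  shows "(U - b)\<^sup>2 = (p - a) * (p + a)\<^sup>2 * (V - c)" "(p - a) * (p + a)\<^sup>2 \<noteq> 0"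
proof -
  have s: "p\<^sup>2 \<noteq> a\<^sup>2" "U - b = (p\<^sup>2 - a\<^sup>2) * s" "V - c = (p - a) * s\<^sup>2"
    using assms by (auto simp: common_solution_def)
  show "(U - b)\<^sup>2 = (p - a) * (p + a)\<^sup>2 * (V - c)" unfolding s(2,3) by Groebner_Basis.algebra
  show "(p - a) * (p + a)\<^sup>2 \<noteq> 0" using s(1) by (auto simp: eq_neg_iff_add_eq_0[symmetric])
qed

text \<open>Two vertices with the same first coordinate share a cubic \<open>q\<close>, so their
  equations give \<open>U\<close> as an affine function of \<open>q p\<close>, and then
  \<open>V\<close>. Hence each \<open>p\<close> has at most one point, and the third equation
  becomes a polynomial condition on \<open>p\<close>. That polynomial is nonzero at
  \<open>p = a\<close>, where \<open>q\<close> vanishes.\<close>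

lemma card_common_solutions_eq_first:
  fixes A :: "('a::field \<times> 'a \<times> 'a) set"
  assumes two: "(2::'a) \<noteq> 0"
    and ne: "(a, b1, c1) \<noteq> (a, b2, c2)" "(a3, b3, c3) \<noteq> (a, b1, c1)" "(a3, b3, c3) \<noteq> (a, b2, c2)"
    and a3: "a3 + a \<noteq> 0"
    and sol: "\<And>u. u \<in> A \<Longrightarrow> \<exists>s1 s2 s3. common_solution u (a, b1, c1) s1 \<and>
       common_solution u (a, b2, c2) s2 \<and> common_solution u (a3, b3, c3) s3"
  shows "finite A \<and> card A \<le> 24"
proof (cases "A = {}")
  case False
  define q where "q = (\<lambda>p::'a. (p - a) * (p + a)\<^sup>2)"
  define q3 where "q3 = (\<lambda>p::'a. (p - a3) * (p + a3)\<^sup>2)"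
  have eqs: "(U - b1)\<^sup>2 = q p * (V - c1)" "(U - b2)\<^sup>2 = q p * (V - c2)"
      "(U - b3)\<^sup>2 = q3 p * (V - c3)" "q p \<noteq> 0" "q3 p \<noteq> 0" if "(p, U, V) \<in> A" for p U V
    using sol[OF that] common_solution_cone[of p U V] unfolding q_def q3_def by blast+
  have b12: "b1 \<noteq> b2"
  proof
    assume "b1 = b2"
    obtain p U V where "(p, U, V) \<in> A" using False by (metis all_not_in_conv prod_cases3)
    with eqs[OF this] \<open>b1 = b2\<close> have "q p * (V - c1) = q p * (V - c2)" by simp
    then show False using eqs(4)[OF \<open>(p, U, V) \<in> A\<close>] \<open>b1 = b2\<close> ne by simp
  qed
  define \<beta> where "\<beta> = (b1 + b2) / 2"
  define \<kappa> where "\<kappa> = (c1 - c2) / (2 * (b1 - b2))"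
  have U: "U = \<beta> + \<kappa> * q p" if "(p, U, V) \<in> A" for p U V
  proof -
    have k: "2 * (b1 - b2) * \<kappa> = c1 - c2" using two b12 by (simp add: \<kappa>_def)
    have b: "2 * \<beta> = b1 + b2" using two by (simp add: \<beta>_def)
    have "2 * (b1 - b2) * U = b1\<^sup>2 - b2\<^sup>2 + q p * (c1 - c2)"
      using eqs(1,2)[OF that] by Groebner_Basis.algebra
    also have "\<dots> = 2 * (b1 - b2) * (\<beta> + \<kappa> * q p)" using k b by Groebner_Basis.algebra
    finally show ?thesis using two b12 by simp
  qed
  have fib: "finite {u \<in> A. fst u = p} \<and> card {u \<in> A. fst u = p} \<le> 2" for p
  proof -
    have "{u \<in> A. fst u = p} \<subseteq> {(p, \<beta> + \<kappa> * q p, c1 + (\<beta> + \<kappa> * q p - b1)\<^sup>2 / q p)}"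
    proof clarsimp
      fix U V assume u: "(p, U, V) \<in> A"
      have "V = c1 + (U - b1)\<^sup>2 / q p" using eqs(1,4)[OF u] by simp
      with U[OF u] show "U = \<beta> + \<kappa> * q p \<and> V = c1 + (\<beta> + \<kappa> * q p - b1)\<^sup>2 / q p" by simp
    qed
    from finite_subset[OF this] card_mono[OF _ this] show ?thesis by simp
  qed
  define T where "T = [:\<beta>:] + smult \<kappa> (cone_poly a)"
  have T: "poly T p = \<beta> + \<kappa> * q p" for p by (simp add: T_def q_def)
  have dT: "degree T \<le> 3" unfolding T_def
    by (intro degree_add_le order.trans[OF degree_smult_le] degree_cone_poly) simp
  have q0: "q a = 0" by (simp add: q_def)
  have bb: "2 * \<beta> = b1 + b2" using two by (simp add: \<beta>_def)
  show ?thesis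
  proof (cases "a3 = a")
    case True
    have q3q: "q3 p = q p" for p by (simp add: q3_def q_def True)
    have b': "b3 \<noteq> b1" "b3 \<noteq> b2"
    proof -
      obtain p U V where u: "(p, U, V) \<in> A" using False by (metis all_not_in_conv prod_cases3)
      show "b3 \<noteq> b1" using eqs(1,3,4)[OF u] ne True by (auto simp: q3q)
      show "b3 \<noteq> b2" using eqs(2,3,4)[OF u] ne True by (auto simp: q3q)
    qed
    define P where "P = smult (2 * (b1 - b3)) T + [:b3\<^sup>2 - b1\<^sup>2:] - smult (c1 - c3) (cone_poly a)"
    have P: "poly P p = 2 * (b1 - b3) * (\<beta> + \<kappa> * q p) + b3\<^sup>2 - b1\<^sup>2 - (c1 - c3) * q p" for p
      by (simp add: P_def T q_def)
    \<comment> \<open>At the zero \<open>a\<close> of \<open>q\<close>, the expression for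
      \<open>U\<close> is the midpoint \<open>\<beta>\<close> of \<open>b1\<close> and
      \<open>b2\<close>.\<close>
    have "poly P a = (b1 - b3) * (b2 - b3)" unfolding P q0 using bb by Groebner_Basis.algebra
    then have "P \<noteq> 0" using b' by auto
    moreover have "degree P \<le> 12" unfolding P_def
      by (intro degree_diff_le degree_add_le order.trans[OF degree_smult_le]
          order.trans[OF degree_cone_poly] order.trans[OF dT]) simp_all
    moreover have "poly P (fst u) = 0" if "u \<in> A" for u
    proof -
      obtain p U V where "u = (p, U, V)" by (rule prod_cases3)
      with U that have u: "u = (p, \<beta> + \<kappa> * q p, V)" by blast
      define w where "w = \<beta> + \<kappa> * q p"
      have "(w - b1)\<^sup>2 = q p * (V - c1)" "(w - b3)\<^sup>2 = q p * (V - c3)"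
        using eqs(1,3)[of p w V] that unfolding u w_def by (simp_all add: q3q)
      then have "2 * (b1 - b3) * w + b3\<^sup>2 - b1\<^sup>2 - (c1 - c3) * q p = 0" by Groebner_Basis.algebra
      then show ?thesis by (simp add: P u w_def)
    qed
    ultimately show ?thesis using fib by (rule card_le_of_poly_fibres) auto
  next
    case ne3: False
    \<comment> \<open>The third equation multiplied by \<open>q p\<close>, with
      \<open>q p * V\<close> taken from the first; this avoids dividing by
      \<open>q p\<close>.\<close>
    define P where "P = (T - [:b3:])\<^sup>2 * cone_poly a -
      cone_poly a3 * (smult (c1 - c3) (cone_poly a) + (T - [:b1:])\<^sup>2)"
    have P: "poly P p = (\<beta> + \<kappa> * q p - b3)\<^sup>2 * q p -
        q3 p * ((c1 - c3) * q p + (\<beta> + \<kappa> * q p - b1)\<^sup>2)" for p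
      by (simp add: P_def T q_def q3_def)
    have "\<beta> \<noteq> b1" using bb b12 by (metis add_left_cancel mult_2)
    moreover have "q3 a \<noteq> 0" using ne3 a3 by (simp add: q3_def add.commute)
    ultimately have "poly P a \<noteq> 0" unfolding P q0 by simp
    then have "P \<noteq> 0" by auto
    moreover have "degree P \<le> 12"
    proof -
      have d: "degree ((T - [:c:])\<^sup>2) \<le> 6" for c
      proof -
        have "degree (T - [:c:]) \<le> 3" by (intro degree_diff_le dT) simp
        then show ?thesis using degree_power_le[of "T - [:c:]" 2] by linarith
      qed
      have "degree ((T - [:b3:])\<^sup>2 * cone_poly a) \<le> 6 + 3"
        by (intro order.trans[OF degree_mult_le] add_mono d degree_cone_poly)
      moreover have "degree (smult (c1 - c3) (cone_poly a) + (T - [:b1:])\<^sup>2) \<le> 6"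
        by (intro degree_add_le d order.trans[OF degree_smult_le] order.trans[OF degree_cone_poly]) simp
      then have "degree (cone_poly a3 * (smult (c1 - c3) (cone_poly a) + (T - [:b1:])\<^sup>2)) \<le> 3 + 6"
        by (intro order.trans[OF degree_mult_le] add_mono degree_cone_poly)
      ultimately show ?thesis unfolding P_def by (intro degree_diff_le) simp_all
    qed
    moreover have "poly P (fst u) = 0" if "u \<in> A" for u
    proof -
      obtain p U V where "u = (p, U, V)" by (rule prod_cases3)
      with U that have u: "u = (p, \<beta> + \<kappa> * q p, V)" by blast
      define w where "w = \<beta> + \<kappa> * q p"
      have "(w - b1)\<^sup>2 = q p * (V - c1)" "(w - b3)\<^sup>2 = q3 p * (V - c3)"
        using eqs(1,3)[of p w V] that unfolding u w_def by simp_all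
      then have "(w - b3)\<^sup>2 * q p - q3 p * ((c1 - c3) * q p + (w - b1)\<^sup>2) = 0" by Groebner_Basis.algebra
      then show ?thesis by (simp add: P u w_def)
    qed
    ultimately show ?thesis using fib by (rule card_le_of_poly_fibres) auto
  qed
qed simp

text \<open>If the eliminant is a nonzero polynomial in \<open>p\<close>, it bounds the number of
  values of \<open>p\<close>. If it vanishes identically, the three vertices have a common
  neighbour; as the paths from \<open>u\<close> do not all run through one middle vertex
  (\<open>s1 \<noteq> s2\<close>), \<open>p\<close> must be a root of the quadratic
  \<open>R\<close>.\<close>

lemma card_common_solutions_distinct_first:
  fixes A :: "('a::field \<times> 'a \<times> 'a) set"
  assumes two: "(2::'a) \<noteq> 0"
    and S2: "\<And>a b. a \<in> S \<Longrightarrow> b \<in> S \<Longrightarrow> a + b \<noteq> 0"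
    and S4: "\<And>a b c d. a \<in> S \<Longrightarrow> b \<in> S \<Longrightarrow> c \<in> S \<Longrightarrow> d \<in> S \<Longrightarrow> a + b + c + d \<noteq> 0"
    and aS: "a1 \<in> S" "a2 \<in> S" "a3 \<in> S" and ne: "a1 \<noteq> a2" "a1 \<noteq> a3" "a2 \<noteq> a3"
    and sol: "\<And>u. u \<in> A \<Longrightarrow> fst u \<in> S \<and> (\<exists>s1 s2 s3. s1 \<noteq> s2 \<and> common_solution u (a1, b1, c1) s1 \<and>
       common_solution u (a2, b2, c2) s2 \<and> common_solution u (a3, b3, c3) s3)"
  shows "finite A \<and> card A \<le> 24"
proof -
  define q1 where "q1 = (\<lambda>p::'a. (p - a1) * (p + a1)\<^sup>2)"
  define q2 where "q2 = (\<lambda>p::'a. (p - a2) * (p + a2)\<^sup>2)"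
  define q3 where "q3 = (\<lambda>p::'a. (p - a3) * (p + a3)\<^sup>2)"
  have eqs: "(U - b1)\<^sup>2 = q1 p * (V - c1)" "(U - b2)\<^sup>2 = q2 p * (V - c2)"
      "(U - b3)\<^sup>2 = q3 p * (V - c3)" "q1 p \<noteq> 0" "q2 p \<noteq> 0" "q3 p \<noteq> 0" "p \<in> S"
    if "(p, U, V) \<in> A" for p U V
  proof -
    note sol[OF that] common_solution_cone[of p U V]
    then show "(U - b1)\<^sup>2 = q1 p * (V - c1)" "(U - b2)\<^sup>2 = q2 p * (V - c2)"
      "(U - b3)\<^sup>2 = q3 p * (V - c3)" "q1 p \<noteq> 0" "q2 p \<noteq> 0" "q3 p \<noteq> 0"
      unfolding q1_def q2_def q3_def by blast+
    show "p \<in> S" using sol[OF that] by simp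
  qed
  have sq: "a1\<^sup>2 \<noteq> a2\<^sup>2" "a1\<^sup>2 \<noteq> a3\<^sup>2" "a2\<^sup>2 \<noteq> a3\<^sup>2"
    using ne S2 aS by (auto simp: power2_eq_iff eq_neg_iff_add_eq_0)
  have nz: "a1 \<noteq> 0" "a2 \<noteq> 0" using S2[OF aS(1,1)] S2[OF aS(2,2)] by auto
  have fib: "finite {u \<in> A. fst u = p} \<and> card {u \<in> A. fst u = p} \<le> 2" for p
  proof (cases "{u \<in> A. fst u = p} = {}")
    case False
    then have pS: "p \<in> S" and nz': "q1 p \<noteq> 0" using eqs by auto
    have "q1 p \<noteq> q2 p \<or> q1 p \<noteq> q3 p"
    proof (rule ccontr)
      assume "\<not> ?thesis"
      \<comment> \<open>The \<open>q1 p\<close>, \<open>q2 p\<close>, \<open>q3 p\<close> are values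
        of one cubic in \<open>a\<close>, whose second divided difference at three points is
        \<open>- (p + a1 + a2 + a3)\<close>.\<close>
      then have "(a1 - a2) * (a1 - a3) * (a2 - a3) * (p + a1 + a2 + a3) = 0"
        unfolding q1_def q2_def q3_def by Groebner_Basis.algebra
      then show False using ne S4[OF pS aS] by simp
    qed
    then have "finite (snd ` {u \<in> A. fst u = p}) \<and> card (snd ` {u \<in> A. fst u = p}) \<le> 2"
    proof
      assume "q1 p \<noteq> q2 p"
      then show ?thesis using nz' by (rule card_parabola_Int_le) (use eqs in auto)
    next
      assume "q1 p \<noteq> q3 p"
      then show ?thesis using nz' by (rule card_parabola_Int_le) (use eqs in auto)
    qed
    moreover have "inj_on snd {u \<in> A. fst u = p}" by (auto simp: inj_on_def prod_eq_iff)
    ultimately show ?thesis by (simp add: finite_image_iff card_image)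
  next
    case True
    show ?thesis unfolding True by simp
  qed
  define P where "P = eliminant [:b1:] [:c1:] [:b2:] [:c2:] [:b3:] [:c3:]
    (cone_poly a1) (cone_poly a2) (cone_poly a3)"
  have P: "poly P p = eliminant b1 c1 b2 c2 b3 c3 (q1 p) (q2 p) (q3 p)" for p
    unfolding P_def eliminant_def Let_def q1_def q2_def q3_def
    by (simp only: poly_diff poly_add poly_mult poly_power poly_numeral poly_cone_poly poly_pCons
        poly_0 mult_zero_right add_0_right)
  \<comment> \<open>The bound 12 comes from \<open>M\<close>, which has degree at most 6 and enters
    squared.\<close>
  have dP: "degree P \<le> 12"
  proof -
    have mult: "degree (f * g) \<le> m + n" if "degree f \<le> m" "degree g \<le> n" for f g :: "'a poly" and m n
      using degree_mult_le[of f g] that by linarith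
    have const: "degree [:c:] \<le> n" for c :: 'a and n by simp
    have csq: "[:c:]\<^sup>2 = [:c\<^sup>2:]" for c :: 'a by (simp add: power2_eq_square)
    have cm: "degree ([:c:] * g) \<le> n" if "degree g \<le> n" for c :: 'a and g n using that by simp
    have cm': "degree (g * [:c:]) \<le> n" if "degree g \<le> n" for c :: 'a and g n
      using that by (simp add: mult.commute)
    have Q: "degree (cone_poly a) \<le> 3" for a :: 'a by (rule degree_cone_poly)
    define e2 e3 D M N where defs:
      "e2 = [:b1:]\<^sup>2 - [:b2:]\<^sup>2 + cone_poly a1 * [:c1:] - cone_poly a2 * [:c2:]"
      "e3 = [:b1:]\<^sup>2 - [:b3:]\<^sup>2 + cone_poly a1 * [:c1:] - cone_poly a3 * [:c3:]"
      "D = 2 * ([:b1:] - [:b2:]) * (cone_poly a1 - cone_poly a3) - 2 * ([:b1:] - [:b3:]) * (cone_poly a1 - cone_poly a2)"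
      "M = (cone_poly a1 - cone_poly a3) * e2 - (cone_poly a1 - cone_poly a2) * e3"
      "N = 2 * ([:b1:] - [:b2:]) * e3 - 2 * ([:b1:] - [:b3:]) * e2"
    have k: "2 * ([:b1:] - [:b:]) = [:2 * (b1 - b):]" for b
      by (simp add: numeral_poly)
    have e: "degree e2 \<le> 3" "degree e3 \<le> 3" unfolding defs csq
      by (intro degree_diff_le degree_add_le cm' Q const)+
    have D: "degree D \<le> 3" unfolding defs k by (intro degree_diff_le cm Q)
    have M: "degree M \<le> 3 + 3" unfolding defs(4) by (intro degree_diff_le mult Q e)
    have N: "degree N \<le> 3" unfolding defs(5) k by (intro degree_diff_le cm e)
    have "degree (M - [:b1:] * D) \<le> 6" using M D by (intro degree_diff_le cm) auto
    then have "degree ((M - [:b1:] * D)\<^sup>2) \<le> 12"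
      using degree_power_le[of "M - [:b1:] * D" 2] by linarith
    moreover have "degree (cone_poly a1 * (N - [:c1:] * D) * D) \<le> 3 + 3 + 3"
      by (intro mult degree_diff_le cm Q N D)
    ultimately have "degree ((M - [:b1:] * D)\<^sup>2 - cone_poly a1 * (N - [:c1:] * D) * D) \<le> 12"
      by (intro degree_diff_le) auto
    then show ?thesis unfolding P_def eliminant_def Let_def defs .
  qed
  show ?thesis
  proof (cases "P = 0")
    case False
    have "poly P (fst u) = 0" if "u \<in> A" for u
      using that eqs[of "fst u" "fst (snd u)" "snd (snd u)"] by (auto simp: P intro!: eliminant_eq_0)
    with False dP show ?thesis using fib by (rule card_le_of_poly_fibres)
  next
    case True
    define s1 s2 s3 where sdef: "s1 = (b2 - b3) / (a2\<^sup>2 - a3\<^sup>2)" "s2 = (b1 - b3) / (a1\<^sup>2 - a3\<^sup>2)"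
      "s3 = (b1 - b2) / (a1\<^sup>2 - a2\<^sup>2)"
    have s: "b2 - b3 = s1 * (a2\<^sup>2 - a3\<^sup>2)" "b1 - b3 = s2 * (a1\<^sup>2 - a3\<^sup>2)" "b1 - b2 = s3 * (a1\<^sup>2 - a2\<^sup>2)"
      using sq by (simp_all add: sdef)
    \<comment> \<open>The eliminant is a square at the zeros \<open>\<plusminus> a\<^sub>i\<close> of \<open>q\<^sub>i\<close>; comparing the two signs forces
      \<open>s1\<^sup>2 = s2\<^sup>2 = s3\<^sup>2\<close>.\<close>
    have r1: "c2 - c3 + s3\<^sup>2 * (z - a2) - s2\<^sup>2 * (z - a3) = 0" if "z = a1 \<or> z = - a1" for z
    proof (rule eliminant_zero_imp)
      have z2: "z\<^sup>2 = a1\<^sup>2" using that by auto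
      show "b1 - b2 = s3 * (z\<^sup>2 - a2\<^sup>2)" "b1 - b3 = s2 * (z\<^sup>2 - a3\<^sup>2)" "z\<^sup>2 \<noteq> a2\<^sup>2" "z\<^sup>2 \<noteq> a3\<^sup>2"
        using s sq z2 by auto
      have "q1 z = 0" using that by (auto simp: q1_def)
      then show "((z - a2) * (z + a2)\<^sup>2) * ((z - a3) * (z + a3)\<^sup>2) * (c2 - c3) +
          ((z - a3) * (z + a3)\<^sup>2) * (b1 - b2)\<^sup>2 - ((z - a2) * (z + a2)\<^sup>2) * (b1 - b3)\<^sup>2 = 0"
        using P[of z] True eliminant_at_0(1)[of b1 c1 b2 c2 b3 c3 "q2 z" "q3 z"]
        by (simp add: q2_def q3_def)
    qed
    have r2: "c1 - c3 + s3\<^sup>2 * (z - a1) - s1\<^sup>2 * (z - a3) = 0" if "z = a2 \<or> z = - a2" for z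
    proof (rule eliminant_zero_imp)
      have z2: "z\<^sup>2 = a2\<^sup>2" using that by auto
      show "b2 - b1 = s3 * (z\<^sup>2 - a1\<^sup>2)" using s(3) z2 by (simp add: algebra_simps)
      show "b2 - b3 = s1 * (z\<^sup>2 - a3\<^sup>2)" "z\<^sup>2 \<noteq> a1\<^sup>2" "z\<^sup>2 \<noteq> a3\<^sup>2"
        using s sq z2 by auto
      have "q2 z = 0" using that by (auto simp: q2_def)
      then show "((z - a1) * (z + a1)\<^sup>2) * ((z - a3) * (z + a3)\<^sup>2) * (c1 - c3) +
          ((z - a3) * (z + a3)\<^sup>2) * (b2 - b1)\<^sup>2 - ((z - a1) * (z + a1)\<^sup>2) * (b2 - b3)\<^sup>2 = 0"
        using P[of z] True eliminant_at_0(2)[of b1 c1 b2 c2 b3 c3 "q1 z" "q3 z"]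
        by (simp add: q1_def q3_def)
    qed
    have "2 * a1 * (s3\<^sup>2 - s2\<^sup>2) = 0" using r1[of a1] r1[of "- a1"] by (simp, Groebner_Basis.algebra)
    then have s32: "s3\<^sup>2 = s2\<^sup>2" using two nz by simp
    have "2 * a2 * (s3\<^sup>2 - s1\<^sup>2) = 0" using r2[of a2] r2[of "- a2"] by (simp, Groebner_Basis.algebra)
    then have s31: "s3\<^sup>2 = s1\<^sup>2" using two nz by simp
    have lin: "s3 * (a1\<^sup>2 - a2\<^sup>2) + s1 * (a2\<^sup>2 - a3\<^sup>2) = s2 * (a1\<^sup>2 - a3\<^sup>2)"
      using s by Groebner_Basis.algebra
    \<comment> \<open>Up to sign all three slopes equal \<open>s1\<close>. By \<open>lin\<close>, a
      mismatch of signs would make \<open>2 * s1\<close> times a difference of two of the squares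
      vanish.\<close>
    have eq: "s2 = s1 \<and> s3 = s1"
    proof (cases "s3 = s1")
      case True
      then have "s1 * (a1\<^sup>2 - a3\<^sup>2) = s2 * (a1\<^sup>2 - a3\<^sup>2)" using lin by (simp add: algebra_simps)
      then show ?thesis using True sq by simp
    next
      case False
      then have s3: "s3 = - s1" using s31 by (auto simp: power2_eq_iff)
      then have s1: "s1 \<noteq> 0" using False by auto
      have "s2 = s1 \<or> s2 = - s1" using s32 s3 by (auto simp: power2_eq_iff)
      then have "2 * s1 * (a1\<^sup>2 - a2\<^sup>2) = 0 \<or> 2 * s1 * (a2\<^sup>2 - a3\<^sup>2) = 0"
        using lin unfolding s3 by (elim disjE) Groebner_Basis.algebra+
      then show ?thesis using s1 two sq by simp
    qed
    \<comment> \<open>So the three vertices have a common neighbour, with first coordinate \<open>\<sigma>\<close>, and \<open>(W, Y)\<close> below is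
      the deviation of \<open>(U, V)\<close> from being adjacent to it as well.\<close>
    define \<sigma> where "\<sigma> = s1"
    have b: "b2 - b3 = \<sigma> * (a2\<^sup>2 - a3\<^sup>2)" "b1 - b2 = \<sigma> * (a1\<^sup>2 - a2\<^sup>2)"
      using s eq by (auto simp: \<sigma>_def)
    have c: "c2 - c3 = \<sigma>\<^sup>2 * (a2 - a3)" "c1 - c3 = \<sigma>\<^sup>2 * (a1 - a3)"
      using r1[of a1] r2[of a2] eq unfolding \<sigma>_def by (simp, Groebner_Basis.algebra)+
    define R where "R = [:a1 * a2 + a1 * a3 + a2 * a3, 0, 1:]"
    have "R \<noteq> 0" "degree R \<le> 12" by (simp_all add: R_def)
    moreover have "poly R (fst u) = 0" if u: "u \<in> A" for u
    proof (rule ccontr)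
      assume nR: "poly R (fst u) \<noteq> 0"
      obtain p U V where upuv: "u = (p, U, V)" by (metis prod_cases3)
      note E = eqs(1-3)[OF u[unfolded upuv]]
      define W where "W = U - b1 - \<sigma> * (p\<^sup>2 - a1\<^sup>2)"
      define Y where "Y = V - c1 - \<sigma>\<^sup>2 * (p - a1)"
      have UW: "U - b1 = \<sigma> * (p\<^sup>2 - a1\<^sup>2) + W" by (simp add: W_def)
      moreover from this have UW2: "U - b2 = \<sigma> * (p\<^sup>2 - a2\<^sup>2) + W" using b(2) by Groebner_Basis.algebra
      ultimately have UW3: "U - b3 = \<sigma> * (p\<^sup>2 - a3\<^sup>2) + W" using b(1) by Groebner_Basis.algebra
      have VY: "V - c1 = \<sigma>\<^sup>2 * (p - a1) + Y" by (simp add: Y_def)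
      moreover from this have VY3: "V - c3 = \<sigma>\<^sup>2 * (p - a3) + Y" using c(2) by Groebner_Basis.algebra
      ultimately have VY2: "V - c2 = \<sigma>\<^sup>2 * (p - a2) + Y" using c(1) by Groebner_Basis.algebra
      have F: "2 * \<sigma> * (p\<^sup>2 - a1\<^sup>2) * W + W\<^sup>2 = q1 p * Y"
          "2 * \<sigma> * (p\<^sup>2 - a2\<^sup>2) * W + W\<^sup>2 = q2 p * Y"
          "2 * \<sigma> * (p\<^sup>2 - a3\<^sup>2) * W + W\<^sup>2 = q3 p * Y"
        using E(1)[unfolded UW VY q1_def] E(2)[unfolded UW2 VY2 q2_def] E(3)[unfolded UW3 VY3 q3_def]
        unfolding q1_def q2_def q3_def by Groebner_Basis.algebra+
      \<comment> \<open>The second divided difference of the equations \<open>F\<close> in the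
        variable \<open>a\<close>; the first divided difference, taken next, leaves \<open>Y\<close>
        times the value of \<open>R\<close>.\<close>
      have "(a1 - a2) * (a1 - a3) * (a2 - a3) * (2 * \<sigma> * W - Y * (p + a1 + a2 + a3)) = 0"
        using F unfolding q1_def q2_def q3_def by Groebner_Basis.algebra
      then have G: "2 * \<sigma> * W = Y * (p + a1 + a2 + a3)" using ne by simp
      have "(a1 - a2) * (Y * (p\<^sup>2 + (a1 * a2 + a1 * a3 + a2 * a3))) = 0"
        using F(1,2) G unfolding q1_def q2_def by Groebner_Basis.algebra
      moreover have "p\<^sup>2 + (a1 * a2 + a1 * a3 + a2 * a3) \<noteq> 0"
        using nR by (simp add: upuv R_def power2_eq_square algebra_simps)
      ultimately have "Y = 0" using ne by simp
      then have "W\<^sup>2 = 0" using F(1) G by Groebner_Basis.algebra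
      then have W0: "W = 0" by simp
      obtain t1 t2 where t: "t1 \<noteq> t2" "p\<^sup>2 \<noteq> a1\<^sup>2" "U - b1 = (p\<^sup>2 - a1\<^sup>2) * t1"
          "p\<^sup>2 \<noteq> a2\<^sup>2" "U - b2 = (p\<^sup>2 - a2\<^sup>2) * t2"
        using sol[OF u] unfolding upuv common_solution_def by auto
      \<comment> \<open>Without deviation both paths have parameter \<open>\<sigma>\<close>, against
        \<open>t1 \<noteq> t2\<close>.\<close>
      have "t1 = \<sigma>" "t2 = \<sigma>" using t UW UW2 W0 by (auto simp: mult.commute)
      then show False using t by simp
    qed
    ultimately show ?thesis using fib by (rule card_le_of_poly_fibres)
  qed
qed

section \<open>The incidence graph\<close>

definition incident :: "'a::field \<times> 'a \<times> 'a \<Rightarrow> 'a \<times> 'a \<times> 'a \<Rightarrow> bool" where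
  "incident = (\<lambda>(a, b, c) (s, d, e). b + d = a\<^sup>2 * s \<and> c + e = a * s\<^sup>2)"

definition swap23 :: "'a \<times> 'b \<times> 'b \<Rightarrow> 'a \<times> 'b \<times> 'b" where
  "swap23 = (\<lambda>(a, b, c). (a, c, b))"

lemma swap23_simps [simp]: "fst (swap23 x) = fst x" "swap23 x = swap23 y \<longleftrightarrow> x = y"
  by (auto simp: swap23_def split: prod.splits)

lemma incident_swap: "incident (swap23 y) (swap23 x) \<longleftrightarrow> incident x y"
  by (auto simp: incident_def swap23_def add.commute mult.commute split: prod.splits)

text \<open>Subtracting the adjacency conditions removes the last two coordinates of
  \<open>y\<close>. Equal first coordinates would force \<open>u = x\<close>, and the last
  hypothesis excludes opposite ones.\<close>

lemma incident_common_solution: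
  assumes "incident x y" "incident u y" "u \<noteq> x" "fst u + fst x \<noteq> 0"
  shows "common_solution u x (fst y)"
proof -
  obtain a b c p U V s d e where xyz: "x = (a, b, c)" "u = (p, U, V)" "y = (s, d, e)"
    by (metis prod_cases3)
  have eqs: "b + d = a\<^sup>2 * s" "c + e = a * s\<^sup>2" "U + d = p\<^sup>2 * s" "V + e = p * s\<^sup>2"
    using assms(1,2) by (auto simp: xyz incident_def)
  have U: "U - b = (p\<^sup>2 - a\<^sup>2) * s" using eqs(1,3) by Groebner_Basis.algebra
  have V: "V - c = (p - a) * s\<^sup>2" using eqs(2,4) by Groebner_Basis.algebra
  have "p \<noteq> a" using U V assms(3) by (auto simp: xyz)
  moreover have "p \<noteq> - a" using assms(4) by (auto simp: xyz)
  ultimately show ?thesis using U V by (auto simp: xyz common_solution_def power2_eq_iff)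
qed

text \<open>Turns distinct middle vertices into distinct parameters of
  \<open>common_solution\<close>.\<close>

lemma incident_fst_eq:
  assumes "incident u y" "incident u y'" "fst y = fst y'"
  shows "y = y'"
proof -
  obtain p U V s d e d' e' where xyz: "u = (p, U, V)" "y = (s, d, e)" "y' = (s, d', e')"
    using assms(3) by (metis prod_cases3 fst_conv)
  have "U + d = U + d'" "V + e = V + e'" using assms(1,2) by (simp_all add: xyz incident_def)
  then show ?thesis by (simp add: xyz)
qed

lemma card_common_neighbours:
  fixes A :: "('a::field \<times> 'a \<times> 'a) set"
  assumes two: "(2::'a) \<noteq> 0"
    and S2: "\<And>a b. a \<in> S \<Longrightarrow> b \<in> S \<Longrightarrow> a + b \<noteq> 0"
    and S4: "\<And>a b c d. a \<in> S \<Longrightarrow> b \<in> S \<Longrightarrow> c \<in> S \<Longrightarrow> d \<in> S \<Longrightarrow> a + b + c + d \<noteq> 0"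
    and xS: "fst x1 \<in> S" "fst x2 \<in> S" "fst x3 \<in> S" and ne: "x1 \<noteq> x2" "x1 \<noteq> x3" "x2 \<noteq> x3"
    and sol: "\<And>u. u \<in> A \<Longrightarrow> fst u \<in> S \<and> u \<noteq> x1 \<and> u \<noteq> x2 \<and> u \<noteq> x3 \<and>
      (\<exists>y1 y2 y3. y1 \<noteq> y2 \<and> incident x1 y1 \<and> incident x2 y2 \<and> incident x3 y3 \<and>
         incident u y1 \<and> incident u y2 \<and> incident u y3)"
  shows "finite A \<and> card A \<le> 24"
proof -
  obtain a1 b1 c1 a2 b2 c2 a3 b3 c3 where x: "x1 = (a1, b1, c1)" "x2 = (a2, b2, c2)" "x3 = (a3, b3, c3)"
    by (metis prod_cases3)
  have aS: "a1 \<in> S" "a2 \<in> S" "a3 \<in> S" using xS x by auto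
  have cs: "fst u \<in> S \<and> (\<exists>s1 s2 s3. s1 \<noteq> s2 \<and> common_solution u x1 s1 \<and>
      common_solution u x2 s2 \<and> common_solution u x3 s3)" if u: "u \<in> A" for u
  proof -
    obtain y1 y2 y3 where y: "y1 \<noteq> y2" "incident x1 y1" "incident x2 y2" "incident x3 y3"
      "incident u y1" "incident u y2" "incident u y3"
      using sol[OF u] by blast
    have "fst y1 \<noteq> fst y2" using incident_fst_eq y by blast
    moreover have "common_solution u x1 (fst y1)" "common_solution u x2 (fst y2)" "common_solution u x3 (fst y3)"
      using sol[OF u] y xS S2 by (intro incident_common_solution; blast)+
    ultimately show ?thesis using sol[OF u] by blast
  qed
  consider "a1 = a2" | "a1 = a3" | "a2 = a3" | "a1 \<noteq> a2" "a1 \<noteq> a3" "a2 \<noteq> a3" by blast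
  then show ?thesis
  proof cases
    case 1
    show ?thesis
    proof (rule card_common_solutions_eq_first[OF two, of a1 b1 c1 b2 c2 a3 b3 c3])
      show "\<exists>s1 s2 s3. common_solution u (a1, b1, c1) s1 \<and> common_solution u (a1, b2, c2) s2 \<and>
          common_solution u (a3, b3, c3) s3" if "u \<in> A" for u
        using cs[OF that] unfolding x 1 by blast
    qed (use ne x 1 S2 aS in auto)
  next
    case 2
    show ?thesis
    proof (rule card_common_solutions_eq_first[OF two, of a1 b1 c1 b3 c3 a2 b2 c2])
      show "\<exists>s1 s2 s3. common_solution u (a1, b1, c1) s1 \<and> common_solution u (a1, b3, c3) s2 \<and>
          common_solution u (a2, b2, c2) s3" if "u \<in> A" for u
        using cs[OF that] unfolding x 2 by blast
    qed (use ne x 2 S2 aS in auto)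
  next
    case 3
    show ?thesis
    proof (rule card_common_solutions_eq_first[OF two, of a2 b2 c2 b3 c3 a1 b1 c1])
      show "\<exists>s1 s2 s3. common_solution u (a2, b2, c2) s1 \<and> common_solution u (a2, b3, c3) s2 \<and>
          common_solution u (a1, b1, c1) s3" if "u \<in> A" for u
        using cs[OF that] unfolding x 3 by blast
    qed (use ne x 3 S2 aS in auto)
  next
    case 4
    show ?thesis
      by (rule card_common_solutions_distinct_first[OF two S2 S4 aS 4 cs[unfolded x]])
  qed
qed

section \<open>Copies in bipartite graphs\<close>

definition bip_edges :: "('a \<Rightarrow> 'b \<Rightarrow> bool) \<Rightarrow> ('a + 'b) set set" where
  "bip_edges R = {{Inl x, Inr y} | x y. R x y}"

lemma bip_edges_iff [simp]:
  "{Inl x, Inr y} \<in> bip_edges R \<longleftrightarrow> R x y" "{Inr y, Inl x} \<in> bip_edges R \<longleftrightarrow> R x y"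
  "{Inl x, Inl x'} \<notin> bip_edges R" "{Inr y, Inr y'} \<notin> bip_edges R"
  by (auto simp: bip_edges_def doubleton_eq_iff)

text \<open>A middle vertex lies opposite to both branch vertices next to it, so all branch vertices
  are on one side; the two alternatives say which.\<close>

lemma subdivided_biclique_bip_edges:
  assumes "subdivided_biclique s t (bip_edges R) x u y" "s > 0" "t > 0"
  shows "(\<exists>x' u' y'. inj_on x' {..<s} \<and> inj_on u' {..<t} \<and> (\<forall>i<s. \<forall>j<t. x' i \<noteq> u' j) \<and>
           inj_on (\<lambda>(i, j). y' i j) ({..<s} \<times> {..<t}) \<and>
           (\<forall>i<s. \<forall>j<t. R (x' i) (y' i j) \<and> R (u' j) (y' i j))) \<or>
         (\<exists>x' u' y'. inj_on x' {..<s} \<and> inj_on u' {..<t} \<and> (\<forall>i<s. \<forall>j<t. x' i \<noteq> u' j) \<and>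
           inj_on (\<lambda>(i, j). y' i j) ({..<s} \<times> {..<t}) \<and>
           (\<forall>i<s. \<forall>j<t. R (y' i j) (x' i) \<and> R (y' i j) (u' j)))"
proof -
  note c = assms(1)[unfolded subdivided_biclique_def]
  have e: "{x i, y i j} \<in> bip_edges R" "{u j, y i j} \<in> bip_edges R" if "i < s" "j < t" for i j
    using c that by blast+
  have isl: "isl v \<longleftrightarrow> \<not> isl w" if "{v, w} \<in> bip_edges R" for v w
    using that by (cases v; cases w) auto
  have yx: "isl (y i j) \<longleftrightarrow> \<not> isl (x i)" "isl (y i j) \<longleftrightarrow> \<not> isl (u j)" if "i < s" "j < t" for i j
    using isl[OF e(1)[OF that]] isl[OF e(2)[OF that]] by auto
  have same: "isl (u j) = isl (x 0)" if "j < t" for j using yx[OF assms(2) that] by blast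
  have same': "isl (x i) = isl (x 0)" if "i < s" for i
    using yx[OF that assms(3)] same[OF assms(3)] by blast
  have samey: "isl (y i j) \<longleftrightarrow> \<not> isl (x 0)" if "i < s" "j < t" for i j
    using yx[OF that] same'[OF that(1)] by blast
  show ?thesis
  proof (cases "isl (x 0)")
    case True
    define x' where "x' = projl \<circ> x"
    define u' where "u' = projl \<circ> u"
    define y' where "y' = (\<lambda>i j. projr (y i j))"
    have X: "x i = Inl (x' i)" if "i < s" for i using same'[OF that] True by (simp add: x'_def)
    have U: "u j = Inl (u' j)" if "j < t" for j using same[OF that] True by (simp add: u'_def)
    have Y: "y i j = Inr (y' i j)" if "i < s" "j < t" for i j using samey[OF that] True by (simp add: y'_def)
    have "inj_on x' {..<s}" "inj_on u' {..<t}" "\<forall>i<s. \<forall>j<t. x' i \<noteq> u' j"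
      using c by (auto simp: inj_on_def X U)
    moreover have "inj_on (\<lambda>(i, j). y' i j) ({..<s} \<times> {..<t})"
      using c by (auto simp: inj_on_def Y)
    moreover have "\<forall>i<s. \<forall>j<t. R (x' i) (y' i j) \<and> R (u' j) (y' i j)"
      using e by (auto simp: X U Y)
    ultimately show ?thesis by blast
  next
    case False
    define x' where "x' = projr \<circ> x"
    define u' where "u' = projr \<circ> u"
    define y' where "y' = (\<lambda>i j. projl (y i j))"
    have X: "x i = Inr (x' i)" if "i < s" for i using same'[OF that] False by (simp add: x'_def)
    have U: "u j = Inr (u' j)" if "j < t" for j using same[OF that] False by (simp add: u'_def)
    have Y: "y i j = Inl (y' i j)" if "i < s" "j < t" for i j using samey[OF that] False by (simp add: y'_def)
    have "inj_on x' {..<s}" "inj_on u' {..<t}" "\<forall>i<s. \<forall>j<t. x' i \<noteq> u' j"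
      using c by (auto simp: inj_on_def X U)
    moreover have "inj_on (\<lambda>(i, j). y' i j) ({..<s} \<times> {..<t})"
      using c by (auto simp: inj_on_def Y)
    moreover have "\<forall>i<s. \<forall>j<t. R (y' i j) (x' i) \<and> R (y' i j) (u' j)"
      using e by (auto simp: X U Y)
    ultimately show ?thesis by blast
  qed
qed

lemma no_common_neighbour_family:
  fixes x u :: "nat \<Rightarrow> 'a::field \<times> 'a \<times> 'a"
  assumes two: "(2::'a) \<noteq> 0"
    and S2: "\<And>a b. a \<in> S \<Longrightarrow> b \<in> S \<Longrightarrow> a + b \<noteq> 0"
    and S4: "\<And>a b c d. a \<in> S \<Longrightarrow> b \<in> S \<Longrightarrow> c \<in> S \<Longrightarrow> d \<in> S \<Longrightarrow> a + b + c + d \<noteq> 0"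
    and inj: "inj_on x {..<3}" "inj_on u {..<25}" "\<forall>i<3. \<forall>j<25. x i \<noteq> u j"
      "inj_on (\<lambda>(i, j). y i j) ({..<3} \<times> {..<25})"
    and S: "\<And>i. i < 3 \<Longrightarrow> fst (x i) \<in> S" "\<And>j. j < 25 \<Longrightarrow> fst (u j) \<in> S"
    and inc: "\<And>i j. i < 3 \<Longrightarrow> j < 25 \<Longrightarrow> incident (x i) (y i j) \<and> incident (u j) (y i j)"
  shows False
proof -
  have "finite (u ` {..<25}) \<and> card (u ` {..<25}) \<le> 24"
  proof (rule card_common_neighbours[OF two S2 S4])
    show "fst (x 0) \<in> S" "fst (x 1) \<in> S" "fst (x 2) \<in> S" using S by auto
    show "x 0 \<noteq> x 1" "x 0 \<noteq> x 2" "x 1 \<noteq> x 2"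
      using inj_onD[OF inj(1), of 0 1] inj_onD[OF inj(1), of 0 2] inj_onD[OF inj(1), of 1 2] by auto
    fix v assume "v \<in> u ` {..<25}"
    then obtain j where j: "j < 25" "v = u j" by auto
    have "y 0 j \<noteq> y 1 j" using inj_onD[OF inj(4), of "(0, j)" "(1, j)"] j by auto
    then have "y 0 j \<noteq> y 1 j \<and> incident (x 0) (y 0 j) \<and> incident (x 1) (y 1 j) \<and> incident (x 2) (y 2 j) \<and>
        incident v (y 0 j) \<and> incident v (y 1 j) \<and> incident v (y 2 j)"
      using inc j by auto
    moreover have "v \<noteq> x 0" "v \<noteq> x 1" "v \<noteq> x 2"
      using inj(3)[rule_format, of 0 j] inj(3)[rule_format, of 1 j] inj(3)[rule_format, of 2 j] j by auto
    ultimately show "fst v \<in> S \<and> v \<noteq> x 0 \<and> v \<noteq> x 1 \<and> v \<noteq> x 2 \<and>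
      (\<exists>y1 y2 y3. y1 \<noteq> y2 \<and> incident (x 0) y1 \<and> incident (x 1) y2 \<and> incident (x 2) y3 \<and>
         incident v y1 \<and> incident v y2 \<and> incident v y3)" using S(2) j by blast
  qed
  then show False using card_image[OF inj(2)] by simp
qed

lemma incidence_graph_free:
  fixes S :: "'a::field set"
  assumes two: "(2::'a) \<noteq> 0"
    and S2: "\<And>a b. a \<in> S \<Longrightarrow> b \<in> S \<Longrightarrow> a + b \<noteq> 0"
    and S4: "\<And>a b c d. a \<in> S \<Longrightarrow> b \<in> S \<Longrightarrow> c \<in> S \<Longrightarrow> d \<in> S \<Longrightarrow> a + b + c + d \<noteq> 0"
  shows "\<not> subdivided_biclique 3 25
    (bip_edges (\<lambda>x y. x \<in> S \<times> F \<and> y \<in> S \<times> F \<and> incident x y)) x u y"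
proof
  let ?R = "\<lambda>x y. x \<in> S \<times> F \<and> y \<in> S \<times> F \<and> incident x y"
  assume "subdivided_biclique 3 25 (bip_edges ?R) x u y"
  from subdivided_biclique_bip_edges[OF this zero_less_numeral zero_less_numeral]
  show False
  proof (elim disjE exE conjE)
    fix x' u' y'
    assume inj: "inj_on x' {..<3}" "inj_on u' {..<25}" "\<forall>i<3. \<forall>j<25. x' i \<noteq> u' j"
        "inj_on (\<lambda>(i, j). y' i j) ({..<3} \<times> {..<25})"
      and R: "\<forall>i<3::nat. \<forall>j<25::nat. (x' i \<in> S \<times> F \<and> y' i j \<in> S \<times> F \<and> incident (x' i) (y' i j)) \<and>
        u' j \<in> S \<times> F \<and> y' i j \<in> S \<times> F \<and> incident (u' j) (y' i j)"
    show False
    proof (rule no_common_neighbour_family[OF two S2 S4 inj])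
      show "fst (x' i) \<in> S" if "i < 3" for i using R[rule_format, OF that, of 0] by (auto simp: mem_Times_iff)
      show "fst (u' j) \<in> S" if "j < 25" for j using R[rule_format, OF _ that, of 0] by (auto simp: mem_Times_iff)
    qed (use R in auto)
  next
    fix x' u' y'
    assume inj: "inj_on x' {..<3}" "inj_on u' {..<25}" "\<forall>i<3. \<forall>j<25. x' i \<noteq> u' j"
        "inj_on (\<lambda>(i, j). y' i j) ({..<3} \<times> {..<25})"
      and R: "\<forall>i<3::nat. \<forall>j<25::nat. (y' i j \<in> S \<times> F \<and> x' i \<in> S \<times> F \<and> incident (y' i j) (x' i)) \<and>
        y' i j \<in> S \<times> F \<and> u' j \<in> S \<times> F \<and> incident (y' i j) (u' j)"
    show False
    proof (rule no_common_neighbour_family[OF two S2 S4, where x = "swap23 \<circ> x'" and u = "swap23 \<circ> u'" and y = "\<lambda>i j. swap23 (y' i j)"])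
      show "inj_on (swap23 \<circ> x') {..<3}" "inj_on (swap23 \<circ> u') {..<25}"
        "\<forall>i<3. \<forall>j<25. (swap23 \<circ> x') i \<noteq> (swap23 \<circ> u') j"
        using inj(1-3) by (auto simp: inj_on_def)
      show "inj_on (\<lambda>(i, j). swap23 (y' i j)) ({..<3} \<times> {..<25})"
        using inj(4) by (auto simp: inj_on_def)
      show "fst ((swap23 \<circ> x') i) \<in> S" if "i < 3" for i using R[rule_format, OF that, of 0] by (auto simp: mem_Times_iff)
      show "fst ((swap23 \<circ> u') j) \<in> S" if "j < 25" for j using R[rule_format, OF _ that, of 0] by (auto simp: mem_Times_iff)
    qed (use R in \<open>auto simp: incident_swap\<close>)
  qed
qed

text \<open>An edge is determined by the two first coordinates \<open>a\<close>, \<open>s\<close>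
  and the remaining coordinates \<open>b\<close>, \<open>c\<close> of one end, and all four can be
  chosen freely.\<close>

lemma card_incidence_edges:
  fixes S F :: "'a::field set"
  assumes fin: "finite S" "finite F"
    and cl: "\<And>a s b. a \<in> S \<Longrightarrow> s \<in> S \<Longrightarrow> b \<in> F \<Longrightarrow> a\<^sup>2 * s - b \<in> F \<and> a * s\<^sup>2 - b \<in> F"
  shows "card (bip_edges (\<lambda>x y. x \<in> S \<times> (F \<times> F) \<and> y \<in> S \<times> (F \<times> F) \<and> incident x y)) =
    (card S)\<^sup>2 * (card F)\<^sup>2" (is "card ?E = _")
proof -
  define h where "h = (\<lambda>(a, s, b, c). {Inl (a, b, c), Inr (s, a\<^sup>2 * s - b, a * s\<^sup>2 - c)} ::
    ('a \<times> 'a \<times> 'a + 'a \<times> 'a \<times> 'a) set)"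
  have inj: "inj_on h (S \<times> S \<times> F \<times> F)" by (auto simp: inj_on_def h_def doubleton_eq_iff)
  have "h ` (S \<times> S \<times> F \<times> F) = ?E"
  proof (intro equalityI subsetI)
    fix e assume "e \<in> h ` (S \<times> S \<times> F \<times> F)"
    then show "e \<in> ?E" using cl by (auto simp: h_def incident_def)
  next
    fix e assume "e \<in> ?E"
    then obtain a b c s d e' where e: "e = {Inl (a, b, c), Inr (s, d, e')}" "a \<in> S" "b \<in> F" "c \<in> F" "s \<in> S"
      and eqs: "b + d = a\<^sup>2 * s" "c + e' = a * s\<^sup>2"
      unfolding bip_edges_def incident_def by auto
    have "d = a\<^sup>2 * s - b" "e' = a * s\<^sup>2 - c" using eqs by (simp_all add: algebra_simps)
    then have "e = h (a, s, b, c)" using e by (simp add: h_def)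
    then show "e \<in> h ` (S \<times> S \<times> F \<times> F)" using e by blast
  qed
  then have "card ?E = card (S \<times> S \<times> F \<times> F)" using card_image[OF inj] by simp
  also have "\<dots> = (card S)\<^sup>2 * (card F)\<^sup>2" by (simp add: card_cartesian_product power2_eq_square)
  finally show ?thesis .
qed

section \<open>Finite fields of characteristic three\<close>

text \<open>Split off one root at a time. As the roots are simple, it is not a root of the cofactor,
  and by the product rule the cofactor has simple roots too.\<close>

lemma card_roots_separable:
  fixes p :: "'a::alg_closed_field poly"
  assumes "p \<noteq> 0" "\<And>z. poly p z = 0 \<Longrightarrow> poly (pderiv p) z \<noteq> 0"
  shows "card {z. poly p z = 0} = degree p"
  using assms
proof (induction "degree p" arbitrary: p)
  case 0
  then obtain c where "p = [:c:]" using degree_eq_zeroE by metis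
  then show ?case using 0 by auto
next
  case (Suc n)
  then obtain z where z: "poly p z = 0" using alg_closed_imp_poly_has_root[of p] by auto
  then obtain r where r: "p = [:- z, 1:] * r" using poly_eq_0_iff_dvd by (metis dvdE)
  have "r \<noteq> 0" using r Suc.prems by auto
  then have "degree p = 1 + degree r" unfolding r by (subst degree_mult_eq) auto
  then have deg: "degree r = n" using Suc.hyps(2) by simp
  have pd: "poly (pderiv p) w = poly r w + (w - z) * poly (pderiv r) w" for w
    unfolding r pderiv_mult by (simp add: pderiv_pCons algebra_simps)
  have rz: "poly r z \<noteq> 0" using Suc.prems(2)[OF z] by (simp add: pd)
  have "card {w. poly r w = 0} = degree r"
  proof (rule Suc.hyps(1)[OF deg[symmetric] \<open>r \<noteq> 0\<close>])
    fix w assume "poly r w = 0"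
    then have "poly (pderiv p) w \<noteq> 0" by (intro Suc.prems(2)) (simp add: r)
    then show "poly (pderiv r) w \<noteq> 0" using \<open>poly r w = 0\<close> by (auto simp: pd)
  qed
  moreover have "{w. poly p w = 0} = insert z {w. poly r w = 0}" by (auto simp: r)
  moreover have "finite {w. poly r w = 0}" by (rule poly_roots_finite[OF \<open>r \<noteq> 0\<close>])
  ultimately show ?case using rz deg Suc.hyps(2) by simp
qed

section \<open>The field with three elements and its algebraic closure\<close>

datatype gf3 = G0 | G1 | G2

instantiation gf3 :: field
begin

definition "0 = G0"
definition "1 = G1"

fun plus_gf3 :: "gf3 \<Rightarrow> gf3 \<Rightarrow> gf3" where
  "G0 + y = y" | "G1 + G0 = G1" | "G1 + G1 = G2" | "G1 + G2 = G0"
| "G2 + G0 = G2" | "G2 + G1 = G0" | "G2 + G2 = G1"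

fun uminus_gf3 :: "gf3 \<Rightarrow> gf3" where
  "- G0 = G0" | "- G1 = G2" | "- G2 = G1"

fun times_gf3 :: "gf3 \<Rightarrow> gf3 \<Rightarrow> gf3" where
  "G0 * y = G0" | "G1 * y = y" | "G2 * y = - y"

definition "x - y = x + - (y :: gf3)"
text \<open>Both nonzero elements are their own inverses.\<close>

definition "inverse x = (x :: gf3)"
definition "x div y = x * inverse (y :: gf3)"

instance
proof
  fix a b c :: gf3
  show "a * b * c = a * (b * c)" by (cases a; cases b; cases c) simp_all
  show "a * b = b * a" by (cases a; cases b) simp_all
  show "1 * a = a" by (simp add: one_gf3_def)
  show "a + b + c = a + (b + c)" by (cases a; cases b; cases c) simp_all
  show "a + b = b + a" by (cases a; cases b) simp_all
  show "0 + a = a" by (simp add: zero_gf3_def)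
  show "- a + a = 0" by (cases a) (simp_all add: zero_gf3_def)
  show "a - b = a + - b" by (simp add: minus_gf3_def)
  show "(a + b) * c = a * c + b * c" by (cases a; cases b; cases c) simp_all
  show "(0::gf3) \<noteq> 1" by (simp add: zero_gf3_def one_gf3_def)
  show "a \<noteq> 0 \<Longrightarrow> inverse a * a = 1"
    by (cases a) (simp_all add: zero_gf3_def one_gf3_def inverse_gf3_def)
  show "a div b = a * inverse b" by (simp add: divide_gf3_def)
  show "inverse (0::gf3) = 0" by (simp add: inverse_gf3_def)
qed

end

type_synonym gf3_closure = "gf3 alg_closure"

lemma three_eq_0: "(3 :: gf3_closure) = 0"
proof -
  have "(3 :: gf3) = 1 + 1 + 1" by simp
  also have "\<dots> = 0" by (simp add: one_gf3_def zero_gf3_def)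
  finally show ?thesis by (metis to_ac_0 to_ac_numeral)
qed

lemma two_neq_0: "(2 :: gf3_closure) \<noteq> 0"
proof
  assume "(2 :: gf3_closure) = 0"
  moreover have "(3 :: gf3_closure) = 2 + 1" by simp
  ultimately show False using three_eq_0 by simp
qed

lemma cube_add: "(x + y) ^ 3 = x ^ 3 + (y :: gf3_closure) ^ 3"
proof -
  have "(x + y) ^ 3 = x ^ 3 + y ^ 3 + 3 * (x * y * (x + y))"
    by (simp add: power3_eq_cube algebra_simps)
  then show ?thesis by (simp add: three_eq_0)
qed

lemma frobenius_add: "(x + y) ^ (3 ^ k) = x ^ (3 ^ k) + (y :: gf3_closure) ^ (3 ^ k)"
  by (induction k) (simp_all add: power_mult cube_add mult.commute[of 3])

lemma frobenius_uminus: "(- x) ^ (3 ^ k) = - ((x :: gf3_closure) ^ (3 ^ k))"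
  by (simp add: power_minus_odd)

lemma cube_sum: "(\<Sum>i\<in>I. f i) ^ 3 = (\<Sum>i\<in>I. (f i :: gf3_closure) ^ 3)"
  by (induction I rule: infinite_finite_induct) (simp_all add: cube_add)

text \<open>Inside the algebraic closure of the field with three elements, \<open>gf k\<close> is the field with \<open>3 ^ k\<close>
  elements and \<open>gf_trace k\<close> its trace to the prime field. Sums of two or four elements of trace one
  have trace 2 or 1, so they do not vanish.\<close>

definition gf :: "nat \<Rightarrow> gf3_closure set" where
  "gf k = {z. z ^ (3 ^ k) = z}"

definition gf_trace :: "nat \<Rightarrow> gf3_closure \<Rightarrow> gf3_closure" where
  "gf_trace k z = (\<Sum>j<k. z ^ (3 ^ j))"

definition trace_one :: "nat \<Rightarrow> gf3_closure set" where
  "trace_one k = {z. gf_trace k z = 1}"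

lemma gf_closed:
  assumes "x \<in> gf k" "y \<in> gf k"
  shows "x + y \<in> gf k" "x - y \<in> gf k" "x * y \<in> gf k"
  using assms frobenius_add[of x y k] frobenius_add[of x "- y" k]
  by (auto simp: gf_def power_mult_distrib frobenius_uminus)

lemma gf_trace_add: "gf_trace k (x + y) = gf_trace k x + gf_trace k y"
  by (simp add: gf_trace_def frobenius_add sum.distrib)

text \<open>The trace \<open>t\<close> of \<open>z\<close> satisfies
  \<open>z + t ^ 3 = t + z ^ (3 ^ k)\<close>, and for \<open>t = 1\<close> the traces cancel. This
  holds in the whole closure, so \<open>trace_one k\<close> can be defined without reference to
  \<open>gf k\<close>.\<close>

lemma trace_one_subset: "trace_one k \<subseteq> gf k"
proof
  fix z assume z: "z \<in> trace_one k"
  have "gf_trace k z ^ 3 = (\<Sum>j<k. z ^ (3 ^ Suc j))"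
    by (simp add: gf_trace_def cube_sum power_mult[symmetric] mult.commute)
  also have "z + \<dots> = (\<Sum>j<Suc k. z ^ (3 ^ j))" unfolding sum.lessThan_Suc_shift by simp
  also have "\<dots> = gf_trace k z + z ^ (3 ^ k)" by (simp add: gf_trace_def)
  finally show "z \<in> gf k" using z by (simp add: trace_one_def gf_def)
qed

lemma trace_one_sum_neq_0:
  assumes "a \<in> trace_one k" "b \<in> trace_one k"
  shows "a + b \<noteq> 0" and "c \<in> trace_one k \<Longrightarrow> d \<in> trace_one k \<Longrightarrow> a + b + c + d \<noteq> 0"
proof -
  have 0: "gf_trace k 0 = 0" by (simp add: gf_trace_def power_0_left)
  have "gf_trace k (a + b) = 2" using assms by (simp add: gf_trace_add trace_one_def)
  then show "a + b \<noteq> 0" using 0 two_neq_0 by auto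
  assume "c \<in> trace_one k" "d \<in> trace_one k"
  then have "gf_trace k (a + b + c + d) = 3 + 1" using assms by (simp add: gf_trace_add trace_one_def)
  then show "a + b + c + d \<noteq> 0" using 0 three_eq_0 by auto
qed

lemma of_nat_power_3: "j > 0 \<Longrightarrow> (of_nat (3 ^ j) :: gf3_closure) = 0"
  by (simp add: three_eq_0)

text \<open>In characteristic three \<open>X ^ (3 ^ k) - X\<close> has derivative -1, so its roots
  are simple.\<close>

lemma card_gf:
  assumes "k > 0"
  shows "finite (gf k)" "card (gf k) = 3 ^ k"
proof -
  define p :: "gf3_closure poly" where "p = monom 1 (3 ^ k) - monom 1 1"
  have lt: "1 < (3::nat) ^ k" by (rule one_less_power) (use assms in auto)
  have d: "degree p = 3 ^ k" unfolding p_def diff_conv_add_uminus using lt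
    by (subst degree_add_eq_left) (simp_all add: degree_monom_eq)
  have p0: "p \<noteq> 0" using d lt by auto
  have e: "{z. poly p z = 0} = gf k" by (auto simp: p_def gf_def poly_monom)
  have "pderiv p = - 1"
    unfolding p_def pderiv_diff pderiv_monom of_nat_power_3[OF assms]
    by (simp add: monom_0 one_pCons)
  then have "card {z. poly p z = 0} = degree p"
    using p0 by (intro card_roots_separable) auto
  then show "card (gf k) = 3 ^ k" using e d by simp
  show "finite (gf k)" using poly_roots_finite[OF p0] e by simp
qed

text \<open>The trace polynomial minus one has degree \<open>3 ^ (k - 1)\<close> and derivative 1,
  so again all roots are simple.\<close>

lemma card_trace_one:
  assumes "k > 0"
  shows "card (trace_one k) = 3 ^ (k - 1)"
proof -
  define p :: "gf3_closure poly" where "p = (\<Sum>j<k. monom 1 (3 ^ j)) - 1"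
  obtain m where k: "k = Suc m" using assms by (cases k) auto
  have d: "degree p = 3 ^ m"
  proof -
    have "coeff p i = 0" if "i > 3 ^ m" for i
    proof -
      have "(3::nat) ^ j \<noteq> i" if "j < k" for j
        using power_increasing[of j m "3::nat"] that k \<open>i > 3 ^ m\<close> by auto
      then show ?thesis using that by (auto simp: p_def coeff_sum coeff_1 intro!: sum.neutral)
    qed
    then have "degree p \<le> 3 ^ m" by (rule degree_le[rule_format])
    moreover have "coeff p (3 ^ m) \<noteq> 0 \<or> m = 0"
      by (auto simp: p_def coeff_sum coeff_1 k sum.delta)
    moreover have "degree p = 1" if "m = 0"
      using that by (simp add: p_def k monom_altdef one_pCons)
    ultimately show ?thesis using le_degree[of p "3 ^ m"] by (cases "m = 0") auto
  qed
  have p0: "p \<noteq> 0" using d by auto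
  have e: "{z. poly p z = 0} = trace_one k"
    by (auto simp: p_def trace_one_def gf_trace_def poly_monom poly_sum)
  have "pderiv p = (\<Sum>j<k. pderiv (monom 1 (3 ^ j)))" by (simp add: p_def pderiv_diff higher_pderiv_sum[of 1, simplified])
  also have "\<dots> = pderiv (monom 1 1) + (\<Sum>j<m. pderiv (monom 1 (3 ^ Suc j)))"
    unfolding k sum.lessThan_Suc_shift by simp
  also have "(\<Sum>j<m. pderiv (monom (1::gf3_closure) (3 ^ Suc j))) = 0"
    by (intro sum.neutral ballI) (simp only: pderiv_monom of_nat_power_3[OF zero_less_Suc] mult_zero_left monom_0 mult_zero_right monom_eq_0)
  finally have "pderiv p = 1" by (simp add: pderiv_monom monom_0 one_pCons)
  then have "card {z. poly p z = 0} = degree p" using p0 by (intro card_roots_separable) auto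
  then show ?thesis using e d k by simp
qed

section \<open>The lower bound\<close>

text \<open>The trace condition cuts the first coordinates down to a third of the field, which
  leaves at most \<open>2 * 27 ^ k / 3\<close> vertices and exactly \<open>81 ^ k / 9\<close>
  edges.\<close>

lemma turan_number_ge_power:
  assumes "k > 0" "27 ^ k \<le> n"
  shows "81 ^ k \<le> 9 * turan_number n (one_subdivision (complete_bipartite 3 25))"
proof -
  define S where "S = trace_one k"
  define F where "F = gf k"
  define W where "W = S \<times> (F \<times> F)"
  define E where "E = bip_edges (\<lambda>x y. x \<in> W \<and> y \<in> W \<and> incident x y)"
  obtain m where k: "k = Suc m" using assms(1) by (cases k) auto
  have F: "finite F" "card F = 3 ^ k" using card_gf[OF assms(1)] by (simp_all add: F_def)
  have SF: "S \<subseteq> F" using trace_one_subset by (simp add: S_def F_def)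
  have S: "finite S" "card S = 3 ^ m"
    using finite_subset[OF SF F(1)] card_trace_one[OF assms(1)] k by (simp_all add: S_def)
  have cl: "a\<^sup>2 * s - b \<in> F \<and> a * s\<^sup>2 - b \<in> F" if "a \<in> S" "s \<in> S" "b \<in> F" for a s b
    using that SF unfolding F_def power2_eq_square by (auto intro!: gf_closed)
  have cE: "card E = (3 ^ m)\<^sup>2 * (3 ^ k)\<^sup>2"
    unfolding E_def W_def using card_incidence_edges[OF S(1) F(1) cl] S(2) F(2) by simp
  have "card E \<le> turan_number n (one_subdivision (complete_bipartite 3 25))"
  proof (rule card_edges_le_turan_number)
    show "finite E" using cE by (intro card_ge_0_finite) simp
    show "card e = 2" if "e \<in> E" for e using that by (auto simp: E_def bip_edges_def)
    have "card (\<Union>E) \<le> card (W <+> W)"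
      using S F by (intro card_mono) (auto simp: E_def bip_edges_def W_def)
    also have "\<dots> = 2 * (3 ^ m * (3 ^ k * 3 ^ k))"
      using S F by (subst card_Plus) (simp_all add: W_def card_cartesian_product)
    also have "\<dots> \<le> 3 * (3 ^ m * (3 ^ k * 3 ^ k))" by simp
    also have "\<dots> = 27 ^ k" by (simp add: k power_mult_distrib[symmetric])
    also have "\<dots> \<le> n" by (rule assms)
    finally show "card (\<Union>E) \<le> n" .
    show "\<not> subdivided_biclique 3 25 E x u y" for x u y
      unfolding E_def W_def S_def
      by (rule incidence_graph_free[OF two_neq_0 trace_one_sum_neq_0(1) trace_one_sum_neq_0(2)])
  qed simp_all
  moreover have "9 * card E = 81 ^ k"
    unfolding cE by (simp add: k power2_eq_square power_mult_distrib[symmetric])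
  ultimately show ?thesis by linarith
qed

lemma turan_number_lower_bound:
  assumes "n \<ge> 27"
  shows "1 / 729 * real n powr (4 / 3) \<le> real (turan_number n (one_subdivision (complete_bipartite 3 25)))"
proof -
  \<comment> \<open>Rounding \<open>n\<close> down to a power of 27 costs a factor
    \<open>27 powr (4 / 3) = 81\<close>; together with the 9 of the previous lemma this makes
    729.\<close>
  obtain k where k: "27 ^ k \<le> n" "n < 27 ^ (k + 1)"
    using ex_power_ivl1[of 27 n] assms by auto
  have "k > 0" using k assms by (cases k) auto
  have "real n powr (4 / 3) \<le> real (27 ^ (k + 1)) powr (4 / 3)"
    using k(2) by (intro powr_mono2) (auto simp del: of_nat_power)
  also have "real (27 ^ (k + 1)) = 3 powr (3 * real (k + 1))"
    by (simp add: powr_mult[symmetric] powr_powr[symmetric] powr_realpow[symmetric] powr_add)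
  also have "\<dots> powr (4 / 3) = 3 powr (4 * real (k + 1))" by (simp add: powr_powr add_divide_distrib)
  also have "\<dots> = 81 ^ (k + 1)"
    by (simp add: powr_powr[symmetric] powr_realpow[symmetric] powr_add)
  finally have "1 / 729 * real n powr (4 / 3) \<le> 81 ^ k / 9" by simp
  also have "\<dots> \<le> real (turan_number n (one_subdivision (complete_bipartite 3 25)))"
    using turan_number_ge_power[OF \<open>k > 0\<close> k(1)]
    by (metis (mono_tags) divide_le_eq_numeral1(1) mult.commute of_nat_le_iff of_nat_mult of_nat_numeral of_nat_power)
  finally show ?thesis .
qed

section \<open>Counting inequalities\<close>

text \<open>The power mean inequality, from the tangent of the cube at the mean \<open>t\<close>:
  \<open>x ^ 3 \<ge> 3 * t\<^sup>2 * x - 2 * t ^ 3\<close> for \<open>x \<ge> 0\<close>.\<close>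

lemma sum_power3_ge:
  fixes d :: "'a \<Rightarrow> real"
  assumes "finite U" "\<And>v. v \<in> U \<Longrightarrow> d v \<ge> 0"
  shows "(\<Sum>v\<in>U. d v) ^ 3 \<le> real (card U) ^ 2 * (\<Sum>v\<in>U. d v ^ 3)"
proof (cases "U = {}")
  case False
  define t where "t = (\<Sum>v\<in>U. d v) / card U"
  have c: "real (card U) > 0" using False assms(1) by (simp add: card_gt_0_iff)
  have t0: "t \<ge> 0" unfolding t_def using assms by (simp add: sum_nonneg)
  have ts: "(\<Sum>v\<in>U. d v) = card U * t" using c by (simp add: t_def)
  have pt: "d v ^ 3 \<ge> 3 * t\<^sup>2 * d v - 2 * t ^ 3" if "v \<in> U" for v
  proof -
    have "0 \<le> (d v - t)\<^sup>2 * (d v + 2 * t)" using assms(2)[OF that] t0 by simp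
    also have "\<dots> = d v ^ 3 - (3 * t\<^sup>2 * d v - 2 * t ^ 3)"
      by (simp add: power2_eq_square power3_eq_cube algebra_simps)
    finally show ?thesis by simp
  qed
  have "card U * t ^ 3 = (\<Sum>v\<in>U. 3 * t\<^sup>2 * d v - 2 * t ^ 3)"
    by (simp add: sum_subtractf sum_distrib_left[symmetric] ts power2_eq_square power3_eq_cube)
  also have "\<dots> \<le> (\<Sum>v\<in>U. d v ^ 3)" by (intro sum_mono pt)
  finally have "real (card U) ^ 2 * (card U * t ^ 3) \<le> real (card U) ^ 2 * (\<Sum>v\<in>U. d v ^ 3)"
    by (rule mult_left_mono) simp
  then show ?thesis by (simp add: ts power2_eq_square power3_eq_cube mult_ac)
qed simp

lemma sum_sqrt_le:
  assumes "finite A" "\<And>u. u \<in> A \<Longrightarrow> f u \<ge> 0"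
  shows "(\<Sum>u\<in>A. sqrt (f u)) \<le> sqrt (real (card A) * (\<Sum>u\<in>A. f u))"
proof (rule real_le_rsqrt)
  have "(\<Sum>u\<in>A. sqrt (f u))\<^sup>2 \<le> real (card A) * (\<Sum>u\<in>A. (sqrt (f u))\<^sup>2)"
    using sum_squared_le_sum_of_squares[of "\<lambda>u. sqrt (f u)" A] by (simp add: mult.commute)
  also have "(\<Sum>u\<in>A. (sqrt (f u))\<^sup>2) = (\<Sum>u\<in>A. f u)" using assms by (intro sum.cong) auto
  finally show "(\<Sum>u\<in>A. sqrt (f u))\<^sup>2 \<le> real (card A) * (\<Sum>u\<in>A. f u)" .
qed

lemma sum_swap3:
  "(\<Sum>v\<in>U. \<Sum>a\<in>Y. \<Sum>b\<in>Y. \<Sum>c\<in>Y. f v a b c) = (\<Sum>a\<in>Y. \<Sum>b\<in>Y. \<Sum>c\<in>Y. \<Sum>v\<in>U. f v a b c)"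
  by (simp add: sum.swap[of _ _ U])

lemma sum_power3_swap:
  fixes h :: "'a \<Rightarrow> 'b \<Rightarrow> real"
  shows "(\<Sum>v\<in>U. (\<Sum>u\<in>Y. h v u) ^ 3) =
    (\<Sum>u1\<in>Y. \<Sum>u2\<in>Y. \<Sum>u3\<in>Y. \<Sum>v\<in>U. h v u1 * h v u2 * h v u3)"
proof -
  have "(\<Sum>u\<in>Y. h v u) ^ 3 = (\<Sum>u1\<in>Y. \<Sum>u2\<in>Y. \<Sum>u3\<in>Y. h v u1 * h v u2 * h v u3)" for v
    by (simp add: power3_eq_cube sum_product sum_distrib_left sum_distrib_right mult_ac)
  then show ?thesis by (simp add: sum_swap3)
qed

lemma sum_power2_swap:
  fixes h :: "'a \<Rightarrow> 'b \<Rightarrow> real"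
  shows "(\<Sum>v\<in>U. (\<Sum>u\<in>Y. h v u)\<^sup>2) = (\<Sum>u1\<in>Y. \<Sum>u2\<in>Y. \<Sum>v\<in>U. h v u1 * h v u2)"
proof -
  have "(\<Sum>u\<in>Y. h v u)\<^sup>2 = (\<Sum>u1\<in>Y. \<Sum>u2\<in>Y. h v u1 * h v u2)" for v
    by (simp add: power2_eq_square sum_product)
  then show ?thesis by (simp add: sum.swap[of _ _ U])
qed

text \<open>The Kovari-Sos-Turan argument. With \<open>x = card U\<close>, the sum of the cubed
  degrees is at most \<open>24 * x ^ 3\<close> from distinct triples plus \<open>3 * x ^ 3\<close>
  from the others. So the number \<open>p\<close> of pairs satisfies
  \<open>p ^ 3 \<le> 27 * x ^ 5\<close>, which is at most \<open>(x\<^sup>2 / 4) ^ 3\<close> once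
  \<open>x\<close> reaches \<open>27 * 64 = 1728\<close>.\<close>

lemma sparse_of_few_common_neighbours:
  assumes fin: "finite U" and big: "card U \<ge> 1729"
    and few: "\<And>u1 u2 u3. u1 \<in> U \<Longrightarrow> u2 \<in> U \<Longrightarrow> u3 \<in> U \<Longrightarrow> u1 \<noteq> u2 \<Longrightarrow> u1 \<noteq> u3 \<Longrightarrow> u2 \<noteq> u3 \<Longrightarrow>
      card {v \<in> U. H v u1 \<and> H v u2 \<and> H v u3} \<le> 24"
  shows "4 * real (card {(v, u). v \<in> U \<and> u \<in> U \<and> H v u}) \<le> real (card U) ^ 2"
proof -
  define x where "x = real (card U)"
  define h where "h = (\<lambda>v u. of_bool (H v u) :: real)"
  define d where "d = (\<lambda>v. \<Sum>u\<in>U. h v u)"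
  have x1: "x \<ge> 1729" using big by (simp add: x_def)
  have d0: "d v \<ge> 0" for v by (simp add: d_def h_def sum_nonneg)
  have tri: "(\<Sum>v\<in>U. h v u1 * h v u2 * h v u3) \<le>
      24 + x * (of_bool (u1 = u2) + of_bool (u1 = u3) + of_bool (u2 = u3))"
    if u: "u1 \<in> U" "u2 \<in> U" "u3 \<in> U" for u1 u2 u3
  proof -
    have "(\<Sum>v\<in>U. h v u1 * h v u2 * h v u3) = real (card {v \<in> U. H v u1 \<and> H v u2 \<and> H v u3})"
      (is "?l = real (card ?c)")
      using fin by (simp add: h_def of_bool_conj[symmetric] sum_of_bool_eq conj_assoc Int_def)
    moreover have "card ?c \<le> card U" using fin by (intro card_mono) auto
    then have "real (card ?c) \<le> x" by (simp add: x_def)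
    moreover have "real (card ?c) \<le> 24" if "u1 \<noteq> u2" "u1 \<noteq> u3" "u2 \<noteq> u3"
      using few[OF u that] by simp
    ultimately show ?thesis using x1 by (cases "u1 = u2"; cases "u1 = u3"; cases "u2 = u3") auto
  qed
  have "(\<Sum>v\<in>U. d v ^ 3) \<le>
    (\<Sum>u1\<in>U. \<Sum>u2\<in>U. \<Sum>u3\<in>U. 24 + x * (of_bool (u1 = u2) + of_bool (u1 = u3) + of_bool (u2 = u3)))"
    unfolding d_def sum_power3_swap by (intro sum_mono tri)
  also have "\<dots> = 27 * x ^ 3"
    using fin by (simp add: sum.distrib sum_distrib_left[symmetric] distrib_left x_def[symmetric]
        of_bool_def sum.delta sum.delta' power3_eq_cube)
  finally have d3: "(\<Sum>v\<in>U. d v ^ 3) \<le> 27 * x ^ 3" .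
  define p where "p = (\<Sum>v\<in>U. d v)"
  have p: "p = real (card {(v, u). v \<in> U \<and> u \<in> U \<and> H v u})"
  proof -
    have "{(v, u). v \<in> U \<and> u \<in> U \<and> H v u} = (SIGMA v:U. {u \<in> U. H v u})" by auto
    then show ?thesis using fin by (simp add: p_def d_def h_def sum_of_bool_eq Int_def)
  qed
  have "p ^ 3 \<le> x\<^sup>2 * (27 * x ^ 3)"
    using sum_power3_ge[OF fin, of d] d0 d3 unfolding p_def x_def
    by (meson mult_left_mono order_trans zero_le_power2)
  also have "\<dots> \<le> (x\<^sup>2 / 4) ^ 3"
  proof -
    have "64 * (x\<^sup>2 * (27 * x ^ 3)) = 1728 * x ^ 5" by (simp add: power_numeral_reduce)
    also have "\<dots> \<le> x * x ^ 5" using x1 by (intro mult_right_mono) auto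
    also have "\<dots> = 64 * (x\<^sup>2 / 4) ^ 3" by (simp add: power_divide power_numeral_reduce)
    finally show ?thesis by linarith
  qed
  finally have "p ^ 3 \<le> (x\<^sup>2 / 4) ^ 3" .
  then have "p \<le> x\<^sup>2 / 4" using power_strict_mono[of "x\<^sup>2 / 4" p 3] by force
  then show ?thesis unfolding p x_def by simp
qed

text \<open>Greedy choice: a set with at least \<open>card I\<close> elements always has one that is
  not yet taken.\<close>

lemma distinct_representatives:
  assumes "finite I" "\<And>i. i \<in> I \<Longrightarrow> finite (f i)" "\<And>i. i \<in> I \<Longrightarrow> card I \<le> card (f i)"
  shows "\<exists>y. inj_on y I \<and> (\<forall>i\<in>I. y i \<in> f i)"
proof -
  have "\<exists>y. inj_on y J \<and> (\<forall>i\<in>J. y i \<in> f i)" if "J \<subseteq> I" for J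
    using finite_subset[OF that assms(1)] that
  proof (induction J rule: finite_induct)
    case (insert j J)
    then obtain y where y: "inj_on y J" "\<forall>i\<in>J. y i \<in> f i" by auto
    have "card (insert j J) \<le> card I" using insert.prems assms(1) by (rule card_mono[rotated])
    then have "card (y ` J) < card (f j)"
      using assms(3)[of j] insert card_image_le[of J y] by simp
    then have "\<not> f j \<subseteq> y ` J" using card_mono[of "y ` J" "f j"] insert.hyps(1) by auto
    then obtain w where w: "w \<in> f j" "w \<notin> y ` J" by blast
    show ?case
    proof (intro exI conjI)
      show "inj_on (y(j := w)) (insert j J)"
        using y(1) w insert.hyps(2) by (auto simp: inj_on_def)
      show "\<forall>i\<in>insert j J. (y(j := w)) i \<in> f i" using y(2) w by auto
    qed
  qed simp
  then show ?thesis by blast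
qed

section \<open>Families of sets of equal size\<close>

text \<open>Read \<open>N w\<close> as the neighbourhood of \<open>w \<in> B\<close> in a bipartite
  graph: these are the copies of the subdivision whose middle vertices all lie in
  \<open>B\<close>.\<close>

definition family_biclique ::
  "'b set \<Rightarrow> ('b \<Rightarrow> 'a set) \<Rightarrow> (nat \<Rightarrow> 'a) \<Rightarrow> (nat \<Rightarrow> 'a) \<Rightarrow> (nat \<Rightarrow> nat \<Rightarrow> 'b) \<Rightarrow> bool" where
  "family_biclique B N x u y \<longleftrightarrow>
     inj_on x {..<3} \<and> inj_on u {..<25} \<and> (\<forall>i<3. \<forall>j<25. x i \<noteq> u j) \<and>
     inj_on (\<lambda>(i, j). y i j) ({..<3} \<times> {..<25}) \<and>
     (\<forall>i<3. \<forall>j<25. y i j \<in> B \<and> x i \<in> N (y i j) \<and> u j \<in> N (y i j))"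

definition triple :: "'a \<Rightarrow> 'a \<Rightarrow> 'a \<Rightarrow> nat \<Rightarrow> 'a" where
  "triple a b c = (\<lambda>i. if i = 0 then a else if i = 1 then b else c)"

lemma less_3_iff: "i < 3 \<longleftrightarrow> i = 0 \<or> i = 1 \<or> i = (2::nat)" by auto

lemma inj_on_triple: "a \<noteq> b \<Longrightarrow> a \<noteq> c \<Longrightarrow> b \<noteq> c \<Longrightarrow> inj_on (triple a b c) {..<3}"
  by (auto simp: inj_on_def triple_def less_3_iff)

locale subset_family =
  fixes A :: "'a set" and B :: "'b set" and N :: "'b \<Rightarrow> 'a set" and D :: nat
  assumes finite_A: "finite A" and finite_B: "finite B"
    and N_subset: "\<And>w. w \<in> B \<Longrightarrow> N w \<subseteq> A"
    and card_N: "\<And>w. w \<in> B \<Longrightarrow> card (N w) = D"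
    and biclique_free: "\<And>x u y. \<not> family_biclique B N x u y"
begin

text \<open>The threshold 75 is the number of edges of \<open>K\<^bsub>3,25\<^esub>\<close>, so that a copy of \<open>K\<^bsub>3,25\<^esub>\<close> made of heavy pairs
  can be subdivided greedily.\<close>

definition common :: "'a \<Rightarrow> 'a \<Rightarrow> 'b set" where
  "common v u = {w \<in> B. v \<in> N w \<and> u \<in> N w}"

definition light :: "'a \<Rightarrow> 'a \<Rightarrow> bool" where
  "light v u \<longleftrightarrow> v \<noteq> u \<and> common v u \<noteq> {} \<and> card (common v u) < 75"

definition heavy :: "'a \<Rightarrow> 'a \<Rightarrow> bool" where
  "heavy v u \<longleftrightarrow> v \<noteq> u \<and> 75 \<le> card (common v u)"

text \<open>With one middle vertex fixed for each light pair, a star is determined by its centre and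
  its three ends.\<close>

definition mid :: "'a \<Rightarrow> 'a \<Rightarrow> 'b" where
  "mid v u = (SOME w. w \<in> common v u)"

definition deg :: "'a \<Rightarrow> real" where
  "deg v = (\<Sum>u\<in>A. of_bool (light v u))"

section \<open>Light and heavy pairs inside a neighbourhood\<close>

lemma finite_common: "finite (common v u)"
  by (simp add: common_def finite_B)

lemma light_mid:
  assumes "light v u"
  shows "mid v u \<in> B" "v \<in> N (mid v u)" "u \<in> N (mid v u)"
proof -
  have "mid v u \<in> common v u" unfolding mid_def by (rule someI_ex) (use assms in \<open>auto simp: light_def\<close>)
  then show "mid v u \<in> B" "v \<in> N (mid v u)" "u \<in> N (mid v u)" by (auto simp: common_def)
qed

lemma finite_N: "w \<in> B \<Longrightarrow> finite (N w)"
  using N_subset finite_A finite_subset by blast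

text \<open>Twenty-five such \<open>v\<close> would form a complete bipartite graph of heavy pairs
  with \<open>u1\<close>, \<open>u2\<close>, \<open>u3\<close>, and distinct representatives of its
  75 sets of common neighbours would subdivide it.\<close>

lemma few_common_heavy:
  assumes "finite Y" "u1 \<noteq> u2" "u1 \<noteq> u3" "u2 \<noteq> u3"
  shows "card {v \<in> Y. heavy v u1 \<and> heavy v u2 \<and> heavy v u3} \<le> 24"
proof (rule ccontr)
  let ?C = "{v \<in> Y. heavy v u1 \<and> heavy v u2 \<and> heavy v u3}"
  assume "\<not> card ?C \<le> 24"
  then obtain T where T: "T \<subseteq> ?C" "card T = 25" "finite T"
    using obtain_subset_with_card_n[of 25 ?C] by (auto simp: not_le)
  obtain u :: "nat \<Rightarrow> 'a" where u: "bij_betw u {..<25} T"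
    using ex_bij_betw_nat_finite[OF T(3)] T(2) by (auto simp: lessThan_atLeast0)
  define x where "x = triple u1 u2 u3"
  have h: "heavy (u j) (x i)" if "i < 3" "j < 25" for i j
    using T(1) bij_betwE[OF u] that by (fastforce simp: x_def triple_def less_3_iff)
  define f where "f = (\<lambda>(i, j). common (u j) (x i))"
  obtain y where y: "inj_on y ({..<3::nat} \<times> {..<25::nat})" "\<forall>i\<in>{..<3} \<times> {..<25}. y i \<in> f i"
    using distinct_representatives[of "{..<3::nat} \<times> {..<25::nat}" f] h
    by (auto simp: f_def finite_common heavy_def)
  have "family_biclique B N x u (\<lambda>i j. y (i, j))"
    unfolding family_biclique_def
  proof (intro conjI)
    show "inj_on x {..<3}" unfolding x_def by (rule inj_on_triple[OF assms(2-4)])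
    show "inj_on u {..<25}" using u by (simp add: bij_betw_def)
    show "\<forall>i<3. \<forall>j<25. x i \<noteq> u j" using h unfolding heavy_def by metis
    show "inj_on (\<lambda>(i, j). y (i, j)) ({..<3} \<times> {..<25})" using y(1) by simp
    show "\<forall>i<3. \<forall>j<25. y (i, j) \<in> B \<and> x i \<in> N (y (i, j)) \<and> u j \<in> N (y (i, j))"
      using y(2) by (auto simp: f_def common_def)
  qed
  then show False using biclique_free by blast
qed

text \<open>All pairs in \<open>Y\<close> have \<open>w\<close> as a common neighbour, so each is
  diagonal, heavy or light; the first two kinds make up at most a quarter each.\<close>

lemma many_light_pairs:
  assumes "w \<in> B" "Y \<subseteq> N w" "card Y \<ge> 1729"
  shows "real (card Y) ^ 2 \<le> 2 * real (card {(v, u). v \<in> Y \<and> u \<in> Y \<and> light v u})"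
proof -
  let ?H = "{(v, u). v \<in> Y \<and> u \<in> Y \<and> heavy v u}" and ?L = "{(v, u). v \<in> Y \<and> u \<in> Y \<and> light v u}"
  have fin: "finite Y" using assms finite_N finite_subset by blast
  have H: "4 * real (card ?H) \<le> real (card Y) ^ 2"
    by (rule sparse_of_few_common_neighbours[OF fin assms(3)]) (use few_common_heavy[OF fin] in blast)
  have "Y \<times> Y \<subseteq> (\<lambda>v. (v, v)) ` Y \<union> ?H \<union> ?L"
  proof
    fix p assume "p \<in> Y \<times> Y"
    then obtain v u where p: "p = (v, u)" "v \<in> Y" "u \<in> Y" by auto
    then have "common v u \<noteq> {}" using assms by (auto simp: common_def)
    then show "p \<in> (\<lambda>v. (v, v)) ` Y \<union> ?H \<union> ?L" using p by (auto simp: heavy_def light_def)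
  qed
  moreover have fHL: "finite ?H" "finite ?L"
    using fin by (auto intro: finite_subset[of _ "Y \<times> Y"])
  ultimately have "card (Y \<times> Y) \<le> card ((\<lambda>v. (v, v)) ` Y \<union> ?H \<union> ?L)"
    using fin by (intro card_mono) auto
  also have "\<dots> \<le> card Y + card ?H + card ?L"
    using card_Un_le[of "(\<lambda>v. (v, v)) ` Y \<union> ?H" ?L] card_Un_le[of "(\<lambda>v. (v, v)) ` Y" ?H]
      card_image_le[OF fin, of "\<lambda>v. (v, v)"] by linarith
  finally have "real (card (Y \<times> Y)) \<le> real (card Y + card ?H + card ?L)" by (simp only: of_nat_le_iff)
  then have *: "real (card Y) ^ 2 \<le> real (card Y) + real (card ?H) + real (card ?L)"
    by (simp add: card_cartesian_product power2_eq_square)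
  have "1729 * real (card Y) \<le> real (card Y) * real (card Y)"
    using assms(3) by (intro mult_right_mono) auto
  then have "4 * real (card Y) \<le> real (card Y) ^ 2" by (simp add: power2_eq_square)
  with * H show ?thesis by linarith
qed

text \<open>Double counting of light pairs inside the sets \<open>N w\<close>: each \<open>w\<close>
  sees at least \<open>D\<^sup>2 / 2\<close> of them, and each light pair is seen at most 74 times.
  This gives 148, rounded to 150.\<close>

lemma card_family_le_light:
  assumes "D \<ge> 1729"
  shows "real (card B) * real D ^ 2 \<le> 150 * (\<Sum>v\<in>A. deg v)"
proof -
  define P where "P = {(v, u). v \<in> A \<and> u \<in> A \<and> light v u}"
  have fP: "finite P" unfolding P_def using finite_A by (auto intro: finite_subset[of _ "A \<times> A"])
  have "real (card B) * real D ^ 2 = (\<Sum>w\<in>B. real D ^ 2)" by simp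
  also have "\<dots> \<le> (\<Sum>w\<in>B. 2 * real (card {p \<in> P. w \<in> common (fst p) (snd p)}))"
  proof (rule sum_mono)
    fix w assume w: "w \<in> B"
    have "{(v, u). v \<in> N w \<and> u \<in> N w \<and> light v u} = {p \<in> P. w \<in> common (fst p) (snd p)}"
      using w N_subset[OF w] by (auto simp: P_def common_def)
    then show "real D ^ 2 \<le> 2 * real (card {p \<in> P. w \<in> common (fst p) (snd p)})"
      using many_light_pairs[OF w order_refl] card_N[OF w] assms by simp
  qed
  also have "\<dots> = 2 * (\<Sum>w\<in>B. \<Sum>p\<in>P. of_bool (w \<in> common (fst p) (snd p)))"
    using fP by (simp add: sum_distrib_left sum_of_bool_eq Int_def)
  also have "\<dots> = 2 * (\<Sum>p\<in>P. \<Sum>w\<in>B. of_bool (w \<in> common (fst p) (snd p)))"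
    by (subst sum.swap) simp
  also have "\<dots> \<le> 2 * (\<Sum>p\<in>P. 74)"
  proof (intro mult_left_mono sum_mono)
    fix p assume "p \<in> P"
    then have "card (common (fst p) (snd p)) \<le> 74" by (auto simp: P_def light_def)
    moreover have "B \<inter> {w. w \<in> common (fst p) (snd p)} = common (fst p) (snd p)"
      by (auto simp: common_def)
    ultimately show "(\<Sum>w\<in>B. of_bool (w \<in> common (fst p) (snd p))) \<le> (74::real)"
      using finite_B by (simp add: sum_of_bool_eq)
  qed simp
  also have "\<dots> = 148 * real (card P)" by simp
  also have "real (card P) = (\<Sum>v\<in>A. deg v)"
  proof -
    have "P = (SIGMA v:A. {u \<in> A. light v u})" by (auto simp: P_def)
    then show ?thesis using finite_A by (simp add: deg_def sum_of_bool_eq Int_def)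
  qed
  also have "148 * (\<Sum>v\<in>A. deg v) \<le> 150 * (\<Sum>v\<in>A. deg v)"
    by (intro mult_right_mono sum_nonneg) (auto simp: deg_def sum_nonneg)
  finally show ?thesis .
qed

section \<open>Stars of light pairs with given ends\<close>

definition centres :: "'a \<Rightarrow> 'a \<Rightarrow> 'a \<Rightarrow> 'a set" where
  "centres u1 u2 u3 = {v \<in> A. light v u1 \<and> light v u2 \<and> light v u3 \<and>
     mid v u1 \<noteq> mid v u2 \<and> mid v u1 \<noteq> mid v u3 \<and> mid v u2 \<noteq> mid v u3}"

lemma centres_perm: "centres u1 u2 u3 = centres u2 u1 u3" "centres u1 u2 u3 = centres u3 u1 u2"
  by (auto simp: centres_def)

lemma finite_centres: "finite (centres u1 u2 u3)"
  using finite_A by (simp add: centres_def)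

text \<open>Take a largest set of centres whose stars use pairwise disjoint sets of middle vertices.
  By freeness it has at most 24 members, hence at most 72 middle vertices, and every star uses one
  of these, for otherwise its centre could be added. The pigeonhole principle over three ends and 72
  vertices gives 216.\<close>

lemma centres_cluster:
  assumes "centres u1 u2 u3 \<noteq> {}"
  shows "\<exists>u\<in>{u1, u2, u3}. \<exists>w\<in>B. card (centres u1 u2 u3) \<le> 216 * card {v \<in> centres u1 u2 u3. mid v u = w}"
proof (rule ccontr)
  assume neg: "\<not> ?thesis"
  define C where "C = centres u1 u2 u3"
  define col where "col = (\<lambda>v. {mid v u1, mid v u2, mid v u3})"
  define indep where "indep = (\<lambda>J. J \<subseteq> C \<and> (\<forall>v\<in>J. \<forall>v'\<in>J. v \<noteq> v' \<longrightarrow> col v \<inter> col v' = {}))"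
  have finC: "finite C" by (simp add: C_def finite_centres)
  have un: "u1 \<noteq> u2" "u1 \<noteq> u3" "u2 \<noteq> u3" using assms by (auto simp: centres_def)
  have small: "card J \<le> 24" if J: "indep J" for J
  proof (rule ccontr)
    assume "\<not> card J \<le> 24"
    then obtain T where T: "T \<subseteq> J" "card T = 25" "finite T"
      using obtain_subset_with_card_n[of 25 J] by (auto simp: not_le)
    obtain u :: "nat \<Rightarrow> 'a" where u: "bij_betw u {..<25} T"
      using ex_bij_betw_nat_finite[OF T(3)] T(2) by (auto simp: lessThan_atLeast0)
    define x where "x = triple u1 u2 u3"
    have uC: "u j \<in> C" "u j \<in> J" if "j < 25" for j
      using bij_betwE[OF u] that T(1) J by (auto simp: indep_def)
    have l: "light (u j) (x i)" if "i < 3" "j < 25" for i j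
      using uC[OF that(2)] that(1) by (auto simp: C_def centres_def x_def triple_def less_3_iff)
    have mc: "mid (u j) (x i) \<in> col (u j)" if "i < 3" for i j
      using that by (auto simp: col_def x_def triple_def less_3_iff)
    have "family_biclique B N x u (\<lambda>i j. mid (u j) (x i))"
      unfolding family_biclique_def
    proof (intro conjI)
      show "inj_on x {..<3}" unfolding x_def by (rule inj_on_triple[OF un])
      show ui: "inj_on u {..<25}" using u by (simp add: bij_betw_def)
      show "\<forall>i<3. \<forall>j<25. x i \<noteq> u j" using l unfolding light_def by metis
      show "inj_on (\<lambda>(i, j). mid (u j) (x i)) ({..<3} \<times> {..<25})"
      proof (rule inj_onI, clarsimp)
        fix i j i' j' assume ij: "i < 3" "j < 25" "i' < 3" "j' < (25::nat)"
          and eq: "mid (u j) (x i) = mid (u j') (x i')"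
        have "u j = u j'"
        proof (rule ccontr)
          assume "u j \<noteq> u j'"
          then have "col (u j) \<inter> col (u j') = {}" using J uC(2) ij by (auto simp: indep_def)
          then show False using mc[OF ij(1), of j] mc[OF ij(3), of j'] eq by auto
        qed
        then have jj: "j = j'" using ui ij by (auto simp: inj_on_def)
        have "i = i'" using eq uC(1)[OF ij(2)] ij(1,3) jj
          by (auto simp: C_def centres_def x_def triple_def less_3_iff)
        with jj show "i = i' \<and> j = j'" by simp
      qed
      show "\<forall>i<3. \<forall>j<25. mid (u j) (x i) \<in> B \<and> x i \<in> N (mid (u j) (x i)) \<and> u j \<in> N (mid (u j) (x i))"
        using l light_mid by blast
    qed
    then show False using biclique_free by blast
  qed
  have "indep {}" by (simp add: indep_def)
  moreover have "\<forall>J. indep J \<longrightarrow> card J < 25" using small by fastforce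
  ultimately obtain J where J: "indep J" "\<And>J'. indep J' \<Longrightarrow> card J' \<le> card J"
    using ex_has_greatest_nat[of indep "{}" card 25] by blast
  have finJ: "finite J" using J(1) finC finite_subset by (auto simp: indep_def)
  define W where "W = (\<Union>v\<in>J. col v)"
  have "card W \<le> (\<Sum>v\<in>J. card (col v))" unfolding W_def by (rule card_UN_le[OF finJ])
  also have "\<dots> \<le> (\<Sum>v\<in>J. 3)" by (intro sum_mono) (simp add: col_def card_insert_if)
  also have "\<dots> \<le> 72" using small[OF J(1)] by simp
  finally have cW: "card W \<le> 72" .
  have finW: "finite W" using finJ by (auto simp: W_def col_def)
  have WB: "W \<subseteq> B" using J(1) light_mid(1) by (auto simp: W_def indep_def C_def centres_def col_def)
  have meet: "col v \<inter> W \<noteq> {}" if v: "v \<in> C" for v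
  proof
    assume e: "col v \<inter> W = {}"
    have "col v \<noteq> {}" by (simp add: col_def)
    then have "v \<notin> J" using e by (auto simp: W_def)
    moreover have "indep (insert v J)" using J(1) v e by (auto simp: indep_def W_def)
    ultimately show False using J(2)[of "insert v J"] finJ by simp
  qed
  let ?I = "{u1, u2, u3} \<times> W"
  let ?P = "\<lambda>(u, w). {v \<in> C. mid v u = w}"
  have cov: "C \<subseteq> (\<Union>p\<in>?I. ?P p)"
  proof
    fix v assume v: "v \<in> C"
    then obtain w where "w \<in> col v" "w \<in> W" using meet by blast
    then show "v \<in> (\<Union>p\<in>?I. ?P p)" using v by (auto simp: col_def)
  qed
  have C0: "card C > 0" using assms finC by (simp add: C_def card_gt_0_iff)
  have "card C \<le> card (\<Union>p\<in>?I. ?P p)"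
    using finC finW by (intro card_mono[OF _ cov]) auto
  also have "\<dots> \<le> (\<Sum>p\<in>?I. card (?P p))" using finW by (intro card_UN_le) auto
  finally have "216 * card C \<le> (\<Sum>p\<in>?I. 216 * card (?P p))" by (simp add: sum_distrib_left[symmetric])
  \<comment> \<open>In each of the at most 216 classes the strict inequality saves one; since
    \<open>card C > 0\<close>, the total falls below \<open>216 * card C\<close>.\<close>
  also have "\<dots> \<le> (\<Sum>p\<in>?I. card C - 1)"
  proof (rule sum_mono)
    fix p assume p: "p \<in> ?I"
    obtain u w where uw: "p = (u, w)" "u \<in> {u1, u2, u3}" "w \<in> B" using p WB by auto
    then have "216 * card {v \<in> C. mid v u = w} < card C" using neg unfolding C_def by (auto simp: not_le)
    then show "216 * card (?P p) \<le> card C - 1" by (simp add: uw)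
  qed
  also have "\<dots> = card ?I * (card C - 1)" by simp
  also have "\<dots> \<le> 216 * (card C - 1)"
  proof (rule mult_right_mono)
    have "card ?I \<le> 3 * 72" unfolding card_cartesian_product
      by (intro mult_mono cW) (auto simp: card_insert_if)
    then show "card ?I \<le> 216" by simp
  qed simp
  finally show False using C0 by simp
qed

section \<open>Bounding the number of stars by clashes\<close>

definition clashes :: "'a set \<Rightarrow> 'a \<Rightarrow> nat" where
  "clashes V u = card {(v, v'). v \<in> V \<and> v' \<in> V \<and> light v v' \<and> mid v u = mid v' u}"

text \<open>A large set of centres has a cluster \<open>Y\<close> of at least 1729 vertices in one
  \<open>N w\<close>. At least half of the pairs in \<open>Y\<close> are light, and each of these is
  a clash. The sum over three ends covers whichever end the cluster belongs to. Here
  \<open>373464 = 216 * 1729\<close> and \<open>93312 = 2 * 216\<^sup>2\<close>.\<close>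

lemma card_centres_le:
  defines "r \<equiv> \<lambda>V u. sqrt (93312 * real (clashes V u))"
  shows "real (card (centres u1 u2 u3)) \<le> 373464 +
    (r (centres u1 u2 u3) u1 + r (centres u1 u2 u3) u2 + r (centres u1 u2 u3) u3)"
proof (cases "card (centres u1 u2 u3) < 373464")
  case True
  have "r V u \<ge> 0" for V u by (simp add: r_def)
  from this[of "centres u1 u2 u3" u1] this[of "centres u1 u2 u3" u2] this[of "centres u1 u2 u3" u3]
  show ?thesis using True by linarith
next
  case False
  define C where "C = centres u1 u2 u3"
  have "C \<noteq> {}" using False by (auto simp: C_def)
  then obtain u w where u: "u \<in> {u1, u2, u3}" and w: "w \<in> B"
    and c: "card C \<le> 216 * card {v \<in> C. mid v u = w}"
    using centres_cluster unfolding C_def by blast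
  define Y where "Y = {v \<in> C. mid v u = w}"
  have finC: "finite C" by (simp add: C_def finite_centres)
  have Y: "card Y \<ge> 1729" using False c unfolding C_def[symmetric] Y_def[symmetric] by linarith
  have "Y \<subseteq> N w" using u light_mid(2) by (auto simp: Y_def C_def centres_def)
  from many_light_pairs[OF w this Y]
  have "real (card Y) ^ 2 \<le> 2 * real (card {(v, u). v \<in> Y \<and> u \<in> Y \<and> light v u})" .
  also have "card {(v, u). v \<in> Y \<and> u \<in> Y \<and> light v u} \<le> clashes C u"
    unfolding clashes_def
  proof (rule card_mono)
    show "finite {(v, v'). v \<in> C \<and> v' \<in> C \<and> light v v' \<and> mid v u = mid v' u}"
      by (rule finite_subset[of _ "C \<times> C"]) (use finC in auto)
  qed (auto simp: Y_def)
  finally have Y2: "real (card Y) ^ 2 \<le> 2 * real (clashes C u)" by simp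
  have "real (card C) \<le> 216 * real (card Y)"
    using c unfolding Y_def[symmetric] by (metis of_nat_le_iff of_nat_mult of_nat_numeral)
  then have "real (card C) ^ 2 \<le> (216 * real (card Y)) ^ 2" by (intro power_mono) auto
  also have "\<dots> \<le> 93312 * real (clashes C u)" using Y2 by (simp add: power_mult_distrib)
  finally have "real (card C) \<le> r C u" unfolding r_def by (rule real_le_rsqrt)
  moreover have "r V u \<ge> 0" for V u by (simp add: r_def)
  from this[of C u1] this[of C u2] this[of C u3] have "r C u \<le> r C u1 + r C u2 + r C u3"
    using u by auto
  ultimately show ?thesis unfolding C_def[symmetric] by linarith
qed

text \<open>A clash at \<open>u1\<close> is determined by a light pair \<open>v, v'\<close>, one of its at most 74 common neighbours \<open>w\<close>,
  and \<open>u1 \<in> N w\<close>.\<close>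

lemma sum_clashes_le:
  "(\<Sum>u1\<in>A. real (clashes (centres u1 u2 u3) u1)) \<le>
    74 * real D * real (card {v \<in> A. light v u2 \<and> light v u3}) ^ 2"
proof -
  define M where "M = {v \<in> A. light v u2 \<and> light v u3}"
  define Q where "Q = (\<lambda>p u1. light (fst p) (snd p) \<and> light (fst p) u1 \<and> light (snd p) u1 \<and>
    mid (fst p) u1 = mid (snd p) u1)"
  have finM: "finite M" using finite_A by (simp add: M_def)
  have "(\<Sum>u1\<in>A. real (clashes (centres u1 u2 u3) u1)) \<le> (\<Sum>u1\<in>A. \<Sum>p\<in>M\<times>M. of_bool (Q p u1))"
  proof (rule sum_mono)
    fix u1
    have "clashes (centres u1 u2 u3) u1 \<le> card {p \<in> M \<times> M. Q p u1}"
      unfolding clashes_def using finM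
      by (intro card_mono) (auto simp: centres_def M_def Q_def)
    then show "real (clashes (centres u1 u2 u3) u1) \<le> (\<Sum>p\<in>M\<times>M. of_bool (Q p u1))"
      using finM by (simp add: sum_of_bool_eq Int_def)
  qed
  also have "\<dots> = (\<Sum>p\<in>M\<times>M. \<Sum>u1\<in>A. of_bool (Q p u1))" by (rule sum.swap)
  also have "\<dots> \<le> (\<Sum>p\<in>M\<times>M. 74 * real D)"
  proof (rule sum_mono)
    fix p
    have "real (card {u1 \<in> A. Q p u1}) \<le> 74 * real D"
    proof (cases "light (fst p) (snd p)")
      case True
      let ?W = "common (fst p) (snd p)"
      have "{u1 \<in> A. Q p u1} \<subseteq> (\<Union>w\<in>?W. N w)"
      proof
        fix u1 assume "u1 \<in> {u1 \<in> A. Q p u1}"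
        then have q: "light (fst p) u1" "light (snd p) u1" "mid (fst p) u1 = mid (snd p) u1"
          by (auto simp: Q_def)
        have "mid (fst p) u1 \<in> ?W" using light_mid[OF q(1)] light_mid[OF q(2)] q(3) by (auto simp: common_def)
        then show "u1 \<in> (\<Union>w\<in>?W. N w)" using light_mid(3)[OF q(1)] by blast
      qed
      then have "card {u1 \<in> A. Q p u1} \<le> card (\<Union>w\<in>?W. N w)"
        using finite_common finite_N by (intro card_mono finite_UN_I) (auto simp: common_def)
      also have "\<dots> \<le> (\<Sum>w\<in>?W. card (N w))" by (rule card_UN_le[OF finite_common])
      also have "\<dots> = card ?W * D" using card_N by (simp add: common_def)
      also have "\<dots> \<le> 74 * D" using True by (intro mult_right_mono) (auto simp: light_def)
      finally show ?thesis by (metis of_nat_le_iff of_nat_mult of_nat_numeral)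
    qed (simp add: Q_def)
    then show "(\<Sum>u1\<in>A. of_bool (Q p u1)) \<le> 74 * real D"
      using finite_A by (simp add: sum_of_bool_eq Int_def)
  qed
  also have "\<dots> = 74 * real D * real (card M) ^ 2"
    by (simp add: card_cartesian_product power2_eq_square)
  finally show ?thesis unfolding M_def .
qed

text \<open>Cauchy-Schwarz over the first end turns the bound on clashes into one linear in the
  number \<open>m\<close> of common light neighbours of the other two; summing \<open>m\<close> over
  these ends gives the squared degrees. The constant satisfies
  \<open>2628\<^sup>2 \<ge> 74 * 93312\<close>, and \<open>7884 = 3 * 2628\<close> accounts for the
  three ends.\<close>

lemma sum_centres_le:
  "(\<Sum>u1\<in>A. \<Sum>u2\<in>A. \<Sum>u3\<in>A. real (card (centres u1 u2 u3))) \<le>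
    373464 * real (card A) ^ 3 + 7884 * sqrt (real (card A) * real D) * (\<Sum>v\<in>A. deg v ^ 2)"
proof -
  define n where "n = real (card A)"
  define g where "g = (\<lambda>a b c. sqrt (93312 * real (clashes (centres a b c) a)))"
  define m where "m = (\<lambda>b c. real (card {v \<in> A. light v b \<and> light v c}))"
  define G where "G = (\<Sum>b\<in>A. \<Sum>c\<in>A. \<Sum>a\<in>A. g a b c)"
  have g_le: "(\<Sum>a\<in>A. g a b c) \<le> 2628 * sqrt (n * D) * m b c" for b c
  proof -
    have "(\<Sum>a\<in>A. g a b c) \<le> sqrt (n * (\<Sum>a\<in>A. 93312 * real (clashes (centres a b c) a)))"
      unfolding g_def n_def by (rule sum_sqrt_le[OF finite_A]) simp
    also have "\<dots> \<le> sqrt (2628\<^sup>2 * (n * D) * (m b c)\<^sup>2)"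
    proof (rule real_sqrt_le_mono)
      have "n * (\<Sum>a\<in>A. 93312 * real (clashes (centres a b c) a)) =
          93312 * n * (\<Sum>a\<in>A. real (clashes (centres a b c) a))"
        by (simp add: sum_distrib_left[symmetric])
      also have "\<dots> \<le> 93312 * n * (74 * real D * (m b c)\<^sup>2)"
        using sum_clashes_le[of b c] by (intro mult_left_mono) (auto simp: m_def n_def)
      also have "\<dots> = 6905088 * (n * D * (m b c)\<^sup>2)" by simp
      also have "\<dots> \<le> 2628\<^sup>2 * (n * D * (m b c)\<^sup>2)"
        by (intro mult_right_mono) (auto simp: n_def)
      finally show "n * (\<Sum>a\<in>A. 93312 * real (clashes (centres a b c) a)) \<le> 2628\<^sup>2 * (n * D) * (m b c)\<^sup>2"
        by (simp add: mult_ac)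
    qed
    also have "\<dots> = 2628 * sqrt (n * D) * m b c"
      by (simp add: real_sqrt_mult m_def)
    finally show ?thesis .
  qed
  have "G \<le> (\<Sum>b\<in>A. \<Sum>c\<in>A. 2628 * sqrt (n * D) * m b c)"
    unfolding G_def by (intro sum_mono g_le)
  also have "\<dots> = 2628 * sqrt (n * D) * (\<Sum>b\<in>A. \<Sum>c\<in>A. m b c)" by (simp add: sum_distrib_left)
  also have "(\<Sum>b\<in>A. \<Sum>c\<in>A. m b c) = (\<Sum>v\<in>A. deg v ^ 2)"
    unfolding deg_def sum_power2_swap m_def using finite_A
    by (simp add: of_bool_conj[symmetric] sum_of_bool_eq Int_def)
  finally have G: "G \<le> 2628 * sqrt (n * D) * (\<Sum>v\<in>A. deg v ^ 2)" .
  have "(\<Sum>u1\<in>A. \<Sum>u2\<in>A. \<Sum>u3\<in>A. real (card (centres u1 u2 u3))) \<le>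
      (\<Sum>u1\<in>A. \<Sum>u2\<in>A. \<Sum>u3\<in>A. 373464 + (g u1 u2 u3 + g u2 u1 u3 + g u3 u1 u2))"
    unfolding g_def
  proof (intro sum_mono)
    fix u1 u2 u3
    show "real (card (centres u1 u2 u3)) \<le> 373464 + (sqrt (93312 * real (clashes (centres u1 u2 u3) u1)) +
        sqrt (93312 * real (clashes (centres u2 u1 u3) u2)) + sqrt (93312 * real (clashes (centres u3 u1 u2) u3)))"
      using card_centres_le[of u1 u2 u3] centres_perm[of u1 u2 u3] by simp
  qed
  also have "\<dots> = 373464 * n ^ 3 + ((\<Sum>u1\<in>A. \<Sum>u2\<in>A. \<Sum>u3\<in>A. g u1 u2 u3) +
      (\<Sum>u1\<in>A. \<Sum>u2\<in>A. \<Sum>u3\<in>A. g u2 u1 u3) + (\<Sum>u1\<in>A. \<Sum>u2\<in>A. \<Sum>u3\<in>A. g u3 u1 u2))"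
    by (simp add: sum.distrib n_def power3_eq_cube)
  also have "(\<Sum>u1\<in>A. \<Sum>u2\<in>A. \<Sum>u3\<in>A. g u1 u2 u3) = G"
  proof -
    have "(\<Sum>u1\<in>A. \<Sum>u2\<in>A. \<Sum>u3\<in>A. g u1 u2 u3) = (\<Sum>u2\<in>A. \<Sum>u1\<in>A. \<Sum>u3\<in>A. g u1 u2 u3)"
      by (rule sum.swap)
    also have "\<dots> = (\<Sum>u2\<in>A. \<Sum>u3\<in>A. \<Sum>u1\<in>A. g u1 u2 u3)" by (intro sum.cong refl sum.swap)
    finally show ?thesis by (simp add: G_def)
  qed
  also have "(\<Sum>u1\<in>A. \<Sum>u2\<in>A. \<Sum>u3\<in>A. g u2 u1 u3) = G"
    unfolding G_def by (intro sum.cong refl sum.swap)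
  also have "(\<Sum>u1\<in>A. \<Sum>u2\<in>A. \<Sum>u3\<in>A. g u3 u1 u2) = G" by (simp add: G_def)
  also have "373464 * n ^ 3 + (G + G + G) \<le> 373464 * n ^ 3 + 7884 * sqrt (n * D) * (\<Sum>v\<in>A. deg v ^ 2)"
    using G by simp
  finally show ?thesis unfolding n_def .
qed

text \<open>Among the \<open>deg v ^ 3\<close> triples of light neighbours of \<open>v\<close>,
  those with two equal middle vertices must be discarded. An end sharing its middle vertex with
  \<open>u\<close> lies in \<open>N (mid v u)\<close>, so each of the three possible coincidences
  costs at most \<open>D * deg v ^ 2\<close>.\<close>

lemma sum_centres_ge:
  "(\<Sum>v\<in>A. deg v ^ 3) - 3 * real D * (\<Sum>v\<in>A. deg v ^ 2) \<le>
    (\<Sum>u1\<in>A. \<Sum>u2\<in>A. \<Sum>u3\<in>A. real (card (centres u1 u2 u3)))"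
proof -
  define l where "l = (\<lambda>v u. of_bool (light v u) :: real)"
  define e where "e = (\<lambda>v u u'. of_bool (mid v u = mid v u') :: real)"
  have l0: "l v u \<ge> 0" for v u by (simp add: l_def)
  have deg: "deg v = (\<Sum>u\<in>A. l v u)" for v by (simp add: deg_def l_def)
  have deg0: "deg v \<ge> 0" for v by (simp add: deg l0 sum_nonneg)
  have same: "l v u * (\<Sum>u'\<in>A. l v u' * e v u u') \<le> l v u * real D" for v u
  proof (cases "light v u")
    case True
    have "(\<Sum>u'\<in>A. l v u' * e v u u') = real (card {u' \<in> A. light v u' \<and> mid v u = mid v u'})"
      using finite_A by (simp add: l_def e_def of_bool_conj[symmetric] sum_of_bool_eq Int_def)
    also have "card {u' \<in> A. light v u' \<and> mid v u = mid v u'} \<le> card (N (mid v u))"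
      using light_mid(1)[OF True] by (intro card_mono finite_N) (auto dest: light_mid(3))
    also have "\<dots> = D" using card_N light_mid(1)[OF True] by simp
    finally show ?thesis by (simp add: l_def)
  qed (simp add: l_def)
  have bad1: "(\<Sum>u1\<in>A. \<Sum>u2\<in>A. \<Sum>u3\<in>A. l v u1 * l v u2 * l v u3 * e v u1 u2) \<le> real D * deg v ^ 2" for v
  proof -
    have "(\<Sum>u1\<in>A. \<Sum>u2\<in>A. \<Sum>u3\<in>A. l v u1 * l v u2 * l v u3 * e v u1 u2) =
        (\<Sum>u1\<in>A. l v u1 * (\<Sum>u2\<in>A. l v u2 * e v u1 u2)) * deg v"
    proof -
      have "(\<Sum>u3\<in>A. l v u1 * l v u2 * l v u3 * e v u1 u2) = l v u1 * (l v u2 * e v u1 u2) * deg v" for u1 u2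
        unfolding deg sum_distrib_left by (intro sum.cong refl) simp
      then show ?thesis by (simp add: sum_distrib_left sum_distrib_right)
    qed
    also have "\<dots> \<le> (\<Sum>u1\<in>A. l v u1 * real D) * deg v"
      by (intro mult_right_mono sum_mono same deg0)
    also have "\<dots> = real D * deg v ^ 2" by (simp add: deg sum_distrib_right[symmetric] power2_eq_square)
    finally show ?thesis .
  qed
  have bad2: "(\<Sum>u1\<in>A. \<Sum>u2\<in>A. \<Sum>u3\<in>A. l v u1 * l v u2 * l v u3 * e v u1 u3) \<le> real D * deg v ^ 2" for v
  proof -
    have "(\<Sum>u1\<in>A. \<Sum>u2\<in>A. \<Sum>u3\<in>A. l v u1 * l v u2 * l v u3 * e v u1 u3) =
      (\<Sum>u1\<in>A. \<Sum>u3\<in>A. \<Sum>u2\<in>A. l v u1 * l v u2 * l v u3 * e v u1 u3)"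
      by (intro sum.cong refl sum.swap)
    also have "\<dots> = (\<Sum>u1\<in>A. \<Sum>u2\<in>A. \<Sum>u3\<in>A. l v u1 * l v u2 * l v u3 * e v u1 u2)"
      by (intro sum.cong refl) simp
    finally show ?thesis using bad1 by simp
  qed
  have bad3: "(\<Sum>u1\<in>A. \<Sum>u2\<in>A. \<Sum>u3\<in>A. l v u1 * l v u2 * l v u3 * e v u2 u3) \<le> real D * deg v ^ 2" for v
  proof -
    have "(\<Sum>u1\<in>A. \<Sum>u2\<in>A. \<Sum>u3\<in>A. l v u1 * l v u2 * l v u3 * e v u2 u3) =
        deg v * (\<Sum>u2\<in>A. l v u2 * (\<Sum>u3\<in>A. l v u3 * e v u2 u3))"
    proof -
      have "(\<Sum>u2\<in>A. \<Sum>u3\<in>A. l v u1 * l v u2 * l v u3 * e v u2 u3) =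
          l v u1 * (\<Sum>u2\<in>A. l v u2 * (\<Sum>u3\<in>A. l v u3 * e v u2 u3))" for u1
        unfolding sum_distrib_left by (intro sum.cong refl) simp
      then show ?thesis by (simp only: deg sum_distrib_right)
    qed
    also have "\<dots> \<le> deg v * (\<Sum>u2\<in>A. l v u2 * real D)"
      by (intro mult_left_mono sum_mono same deg0)
    also have "\<dots> = real D * deg v ^ 2" by (simp add: deg sum_distrib_right[symmetric] power2_eq_square)
    finally show ?thesis .
  qed
  define good where "good = (\<lambda>v u1 u2 u3. of_bool (v \<in> centres u1 u2 u3) :: real)"
  have "deg v ^ 3 - 3 * real D * deg v ^ 2 \<le> (\<Sum>u1\<in>A. \<Sum>u2\<in>A. \<Sum>u3\<in>A. good v u1 u2 u3)"
    if v: "v \<in> A" for v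
  proof -
    have "deg v ^ 3 = (\<Sum>u1\<in>A. \<Sum>u2\<in>A. \<Sum>u3\<in>A. l v u1 * l v u2 * l v u3)"
      using sum_power3_swap[of l A "{v}"] by (simp add: deg)
    also have "\<dots> \<le> (\<Sum>u1\<in>A. \<Sum>u2\<in>A. \<Sum>u3\<in>A. good v u1 u2 u3 + l v u1 * l v u2 * l v u3 * e v u1 u2 +
        l v u1 * l v u2 * l v u3 * e v u1 u3 + l v u1 * l v u2 * l v u3 * e v u2 u3)"
      using v by (intro sum_mono) (auto simp: good_def l_def e_def centres_def of_bool_def)
    also have "\<dots> \<le> (\<Sum>u1\<in>A. \<Sum>u2\<in>A. \<Sum>u3\<in>A. good v u1 u2 u3) + 3 * real D * deg v ^ 2"
      unfolding sum.distrib using bad1[of v] bad2[of v] bad3[of v] by linarith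
    finally show ?thesis by simp
  qed
  then have "(\<Sum>v\<in>A. deg v ^ 3 - 3 * real D * deg v ^ 2) \<le>
      (\<Sum>v\<in>A. \<Sum>u1\<in>A. \<Sum>u2\<in>A. \<Sum>u3\<in>A. good v u1 u2 u3)" by (rule sum_mono)
  also have "\<dots> = (\<Sum>u1\<in>A. \<Sum>u2\<in>A. \<Sum>u3\<in>A. \<Sum>v\<in>A. good v u1 u2 u3)"
    by (rule sum_swap3)
  also have "\<dots> = (\<Sum>u1\<in>A. \<Sum>u2\<in>A. \<Sum>u3\<in>A. real (card (centres u1 u2 u3)))"
  proof (intro sum.cong refl)
    fix u1 u2 u3
    have "A \<inter> {v. v \<in> centres u1 u2 u3} = centres u1 u2 u3" by (auto simp: centres_def)
    then show "(\<Sum>v\<in>A. good v u1 u2 u3) = real (card (centres u1 u2 u3))"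
      using finite_A by (simp add: good_def sum_of_bool_eq)
  qed
  finally show ?thesis by (simp add: sum_subtractf sum_distrib_left)
qed

text \<open>Comparing the two estimates for the number of stars bounds the sum of
  \<open>deg v ^ 3 - G * deg v ^ 2\<close>. For degrees above \<open>2 * G\<close> half of the cube
  absorbs the square; for the others the square term is at most \<open>4 * G ^ 3\<close>. The
  hypothesis on \<open>card A\<close> gives \<open>n\<^sup>2 \<le> s ^ 3\<close>, so the cubes sum
  to order \<open>n * s ^ 3\<close>, and the power mean inequality concludes.\<close>

lemma sum_deg_le:
  assumes "B \<noteq> {}" "card A \<le> D ^ 3"
  shows "(\<Sum>v\<in>A. deg v) \<le> 16000 * real (card A) * sqrt (real (card A) * real D)"
proof -
  define n where "n = real (card A)"
  define s where "s = sqrt (n * D)"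
  \<comment> \<open>\<open>7887 = 7884 + 3\<close>, the last term coming from the discarded triples
    by \<open>D \<le> s\<close>.\<close>
  define G where "G = 7887 * s"
  have n0: "n \<ge> 0" and s0: "s \<ge> 0" by (simp_all add: n_def s_def)
  obtain w where w: "w \<in> B" using assms(1) by blast
  have Dn: "real D \<le> n" using card_mono[OF finite_A N_subset[OF w]] card_N[OF w] by (simp add: n_def)
  have Ds: "real D \<le> s"
    unfolding s_def by (rule real_le_rsqrt) (use Dn in \<open>simp add: power2_eq_square mult_right_mono\<close>)
  have deg0: "deg v \<ge> 0" for v by (simp add: deg_def sum_nonneg)
  have "(\<Sum>v\<in>A. deg v ^ 3) - 3 * real D * (\<Sum>v\<in>A. deg v ^ 2) \<le>
      373464 * n ^ 3 + 7884 * s * (\<Sum>v\<in>A. deg v ^ 2)"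
    using sum_centres_ge sum_centres_le unfolding n_def s_def by (rule order_trans)
  moreover have "3 * real D * (\<Sum>v\<in>A. deg v ^ 2) \<le> 3 * s * (\<Sum>v\<in>A. deg v ^ 2)"
    using Ds by (intro mult_right_mono sum_nonneg) auto
  ultimately have "(\<Sum>v\<in>A. deg v ^ 3) - G * (\<Sum>v\<in>A. deg v ^ 2) \<le> 373464 * n ^ 3"
    unfolding G_def by (simp add: algebra_simps)
  then have *: "(\<Sum>v\<in>A. deg v ^ 3 - G * deg v ^ 2) \<le> 373464 * n ^ 3"
    by (simp add: sum_subtractf sum_distrib_left)
  have pt: "deg v ^ 3 / 2 - 4 * G ^ 3 \<le> deg v ^ 3 - G * deg v ^ 2" for v
  proof (cases "deg v \<le> 2 * G")
    case True
    have "deg v ^ 2 \<le> (2 * G) ^ 2" using True deg0 by (intro power_mono) auto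
    then have "G * deg v ^ 2 \<le> G * (2 * G) ^ 2" using s0 by (intro mult_left_mono) (auto simp: G_def)
    then have "G * deg v ^ 2 \<le> 4 * G ^ 3" by (simp add: power2_eq_square power3_eq_cube)
    moreover have "deg v ^ 3 \<ge> 0" using deg0 by simp
    ultimately show ?thesis by linarith
  next
    case False
    have "2 * G * deg v ^ 2 \<le> deg v * deg v ^ 2" using False by (intro mult_right_mono) auto
    then have "2 * (G * deg v ^ 2) \<le> deg v ^ 3" by (simp add: power2_eq_square power3_eq_cube)
    moreover have "G ^ 3 \<ge> 0" using s0 by (simp add: G_def)
    ultimately show ?thesis by linarith
  qed
  have "(\<Sum>v\<in>A. deg v ^ 3 / 2 - 4 * G ^ 3) \<le> 373464 * n ^ 3"
    using sum_mono[of A, OF pt] * by (rule order_trans)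
  then have d3: "(\<Sum>v\<in>A. deg v ^ 3) \<le> 746928 * n ^ 3 + 8 * n * G ^ 3"
    by (simp add: sum_subtractf sum_divide_distrib[symmetric] n_def)
  have ns: "n\<^sup>2 \<le> s ^ 3"
  proof -
    have "n \<le> real D ^ 3" using assms(2) unfolding n_def by (metis of_nat_le_iff of_nat_power)
    then have "n ^ 3 * n \<le> n ^ 3 * real D ^ 3" using n0 by (intro mult_left_mono) auto
    also have "\<dots> = (s\<^sup>2) ^ 3" using n0 by (simp add: s_def power_mult_distrib)
    finally have "(n\<^sup>2)\<^sup>2 \<le> (s ^ 3)\<^sup>2" by (simp add: power_numeral_reduce mult_ac)
    then show ?thesis by (rule power2_le_imp_le) (use s0 in simp)
  qed
  have "(\<Sum>v\<in>A. deg v) ^ 3 \<le> n\<^sup>2 * (\<Sum>v\<in>A. deg v ^ 3)"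
    unfolding n_def by (rule sum_power3_ge[OF finite_A deg0])
  also have "\<dots> \<le> n\<^sup>2 * (746928 * n ^ 3 + 8 * n * G ^ 3)" using d3 by (intro mult_left_mono) auto
  also have "\<dots> = n ^ 3 * (746928 * n\<^sup>2 + 8 * G ^ 3)"
    by (simp add: algebra_simps power2_eq_square power3_eq_cube)
  also have "\<dots> \<le> n ^ 3 * (746928 * s ^ 3 + 8 * G ^ 3)"
    using ns n0 by (intro mult_left_mono) auto
  also have "\<dots> = n ^ 3 * ((746928 + 8 * 7887 ^ 3) * s ^ 3)"
    by (simp add: G_def power_mult_distrib algebra_simps)
  \<comment> \<open>The constant 16000 is a rounding up of twice 7887 that leaves room for
    746928.\<close>
  also have "\<dots> \<le> n ^ 3 * (16000 ^ 3 * s ^ 3)"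
    using n0 s0 by (intro mult_left_mono mult_right_mono) auto
  also have "\<dots> = (16000 * n * s) ^ 3" by (simp add: power_mult_distrib)
  finally have "(\<Sum>v\<in>A. deg v) ^ 3 \<le> (16000 * n * s) ^ 3" .
  then have "(\<Sum>v\<in>A. deg v) \<le> 16000 * n * s"
    using power_strict_mono[of "16000 * n * s" "\<Sum>v\<in>A. deg v" 3] n0 s0 by force
  then show ?thesis by (simp add: n_def s_def)
qed

text \<open>Compares the lower and the upper bound for the number of light pairs;
  \<open>2400000 = 150 * 16000\<close>.\<close>

lemma card_family_le:
  assumes "D \<ge> 1729" "card A \<le> D ^ 3"
  shows "real (card B) * real D ^ 2 \<le> 2400000 * real (card A) * sqrt (real (card A) * real D)"
proof (cases "B = {}")
  case False
  then show ?thesis using card_family_le_light[OF assms(1)] sum_deg_le[OF False assms(2)] by linarith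
qed simp

end

section \<open>The upper bound\<close>

text \<open>Telescoping: for \<open>x = sqrt m\<close> and \<open>y = sqrt (m + 1)\<close>, the
  difference \<open>2 / x - 2 / y\<close> equals \<open>2 / (x * y * (x + y))\<close>, which is at
  least \<open>1 / y ^ 3\<close>.\<close>

lemma sum_inverse_power32_le:
  fixes K m :: nat
  assumes "0 < K" "K \<le> m"
  shows "(\<Sum>D\<in>{K<..m}. 1 / (real D * sqrt (real D))) \<le> 2 / sqrt (real K) - 2 / sqrt (real m)"
  using assms(2)
proof (induction m rule: dec_induct)
  case (step m)
  define x y where "x = sqrt (real m)" and "y = sqrt (real (Suc m))"
  have x: "x > 0" "x \<le> y" using assms(1) step.hyps by (auto simp: x_def y_def)
  then have y: "y > 0" by linarith
  have yx: "(y - x) * (x + y) = 1" by (simp add: x_def y_def algebra_simps)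
  have "1 / (real (Suc m) * sqrt (real (Suc m))) = 1 / y ^ 3"
    by (simp add: y_def power3_eq_cube)
  also have "\<dots> \<le> 2 / x - 2 / y"
  proof -
    have "x * (y * (x + y)) \<le> y * (y * (y + y))" using x y by (intro mult_mono add_right_mono) auto
    then have le: "x * y * (x + y) \<le> 2 * y ^ 3" by (simp add: power3_eq_cube algebra_simps)
    have "2 / x - 2 / y = 2 * (y - x) / (x * y)" using x y by (simp add: field_simps)
    also have "\<dots> = 2 * ((y - x) * (x + y)) / (x * y * (x + y))" using x y by simp
    also have "\<dots> = 2 / (x * y * (x + y))" by (simp add: yx)
    finally have "2 / x - 2 / y = 2 / (x * y * (x + y))" .
    moreover have "2 / (2 * y ^ 3) \<le> 2 / (x * y * (x + y))"
      using le x y by (intro divide_left_mono) auto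
    ultimately show ?thesis by simp
  qed
  finally have t: "1 / (real (Suc m) * sqrt (real (Suc m))) \<le> 2 / x - 2 / y" .
  have "{K<..Suc m} = insert (Suc m) {K<..m}" using step.hyps by auto
  then have "(\<Sum>D\<in>{K<..Suc m}. 1 / (real D * sqrt (real D))) =
      1 / (real (Suc m) * sqrt (real (Suc m))) + (\<Sum>D\<in>{K<..m}. 1 / (real D * sqrt (real D)))" by simp
  then show ?case using t step.IH unfolding x_def y_def by linarith
qed simp

section \<open>From families of sets of equal size to degree sums\<close>

lemma family_biclique_mono:
  assumes "family_biclique B' N' x u y" "B' \<subseteq> B" "\<And>w. w \<in> B' \<Longrightarrow> N' w \<subseteq> N w"
  shows "family_biclique B N x u y"
  using assms unfolding family_biclique_def by blast

text \<open>Trimming the large neighbourhoods to exactly \<open>D\<close> elements creates no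
  copies, so the bound for sets of equal size applies.\<close>

lemma card_large_degree_le:
  assumes "finite A" "finite B" "\<And>w. w \<in> B \<Longrightarrow> N w \<subseteq> A" "\<And>x u y. \<not> family_biclique B N x u y"
    and "D \<ge> 1729" "card A \<le> D ^ 3"
  shows "real (card {w \<in> B. D \<le> card (N w)}) * real D ^ 2 \<le>
    2400000 * real (card A) * sqrt (real (card A) * real D)"
proof -
  let ?B = "{w \<in> B. D \<le> card (N w)}"
  have "\<exists>T. T \<subseteq> N w \<and> card T = D" if "w \<in> ?B" for w
    using that obtain_subset_with_card_n[of D "N w"] by auto
  then obtain N' where N': "\<And>w. w \<in> ?B \<Longrightarrow> N' w \<subseteq> N w \<and> card (N' w) = D" by metis
  interpret subset_family A ?B N' D
  proof
    show "finite A" "finite ?B" using assms by auto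
    show "N' w \<subseteq> A" "card (N' w) = D" if "w \<in> ?B" for w using N'[OF that] assms(3) that by auto
    show "\<not> family_biclique ?B N' x u y" for x u y
      using family_biclique_mono[of ?B N' x u y B N] N' assms(4) by blast
  qed
  show ?thesis by (rule card_family_le[OF assms(5,6)])
qed

text \<open>The degree sum is the sum over all thresholds \<open>D\<close> of the number
  \<open>b D\<close> of vertices of degree at least \<open>D\<close>. Up to about the cube root
  \<open>c\<close> of \<open>n\<close> the trivial bound \<open>n\<close> contributes at most
  \<open>2 * c ^ 4\<close>. Beyond it \<open>b D\<close> is of order
  \<open>(n / D) powr (3 / 2)\<close>, and the tail contributes at most
  \<open>4800000 * c ^ 4\<close>.\<close>

lemma sum_degree_le:
  assumes "finite A" "finite B" "\<And>w. w \<in> B \<Longrightarrow> N w \<subseteq> A" "\<And>x u y. \<not> family_biclique B N x u y"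
    and n: "card A \<le> n" "card B \<le> n" "1729 ^ 3 \<le> n"
  shows "(\<Sum>w\<in>B. real (card (N w))) \<le> 4800002 * real n powr (4 / 3)"
proof -
  define c where "c = real n powr (1 / 3)"
  have n0: "real n > 0" using n(3) by simp
  have c3: "c ^ 3 = real n"
    using n0 by (simp add: c_def powr_realpow[symmetric] powr_powr)
  have c4: "real n powr (4 / 3) = c ^ 4"
    using n0 by (simp add: c_def powr_realpow[symmetric] powr_powr)
  have c0: "c > 0" using n0 by (simp add: c_def)
  have c1: "c \<ge> 1729"
  proof -
    have "real 1729 ^ 3 \<le> c ^ 3" unfolding c3 using n(3) by (metis of_nat_le_iff of_nat_power)
    then show ?thesis using power_strict_mono[of c 1729 3] c0 by force
  qed
  \<comment> \<open>Rounding up ensures \<open>n \<le> D ^ 3\<close> for every \<open>D > K\<close>,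
    as the bound for large degrees requires.\<close>
  define K where "K = nat \<lceil>c\<rceil>"
  have K: "c \<le> real K" "real K \<le> 2 * c" "K > 0" using c1 unfolding K_def by linarith+
  define b where "b = (\<lambda>D. card {w \<in> B. D \<le> card (N w)})"
  have Nn: "card (N w) \<le> n" if "w \<in> B" for w
    using card_mono[OF assms(1) assms(3)[OF that]] n(1) by simp
  have Kn: "K \<le> n"
  proof -
    have "2 * c \<le> c ^ 2 * c" using c1 by (intro mult_right_mono order_trans[OF _ power_mono[of 1729 c 2]]) auto
    then have "real K \<le> real n" using K(2) c3 by (simp add: power3_eq_cube power2_eq_square)
    then show ?thesis by simp
  qed
  have "(\<Sum>w\<in>B. real (card (N w))) = (\<Sum>w\<in>B. \<Sum>D\<in>{0<..n}. of_bool (D \<le> card (N w)))"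
  proof (rule sum.cong[OF refl])
    fix w assume "w \<in> B"
    then have "{0<..n} \<inter> {D. D \<le> card (N w)} = {0<..card (N w)}" using Nn by fastforce
    then show "real (card (N w)) = (\<Sum>D\<in>{0<..n}. of_bool (D \<le> card (N w)))" by (simp add: sum_of_bool_eq)
  qed
  also have "\<dots> = (\<Sum>D\<in>{0<..n}. \<Sum>w\<in>B. of_bool (D \<le> card (N w)))" by (rule sum.swap)
  also have "\<dots> = (\<Sum>D\<in>{0<..n}. real (b D))"
    using assms(2) by (simp add: b_def sum_of_bool_eq Int_def)
  also have "{0<..n} = {0<..K} \<union> {K<..n}" using Kn by auto
  also have "(\<Sum>D\<in>{0<..K} \<union> {K<..n}. real (b D)) = (\<Sum>D\<in>{0<..K}. real (b D)) + (\<Sum>D\<in>{K<..n}. real (b D))"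
    by (rule sum.union_disjoint) auto
  also have "(\<Sum>D\<in>{0<..K}. real (b D)) \<le> (\<Sum>D\<in>{0<..K}. real n)"
  proof (rule sum_mono)
    fix D
    have "b D \<le> card B" unfolding b_def using assms(2) by (intro card_mono) auto
    then show "real (b D) \<le> real n" using n(2) by simp
  qed
  also have "(\<Sum>D\<in>{0<..K}. real n) = real K * real n" by simp
  also have "\<dots> \<le> 2 * c * real n" using K(2) by (intro mult_right_mono) auto
  also have "\<dots> = 2 * c ^ 4" by (simp add: c3[symmetric] power_numeral_reduce)
  also have "(\<Sum>D\<in>{K<..n}. real (b D)) \<le>
      (\<Sum>D\<in>{K<..n}. 2400000 * real n * sqrt (real n) * (1 / (real D * sqrt (real D))))"
  proof (rule sum_mono)
    fix D assume D: "D \<in> {K<..n}"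
    have cD: "c \<le> real D" using K(1) D by simp
    have D0: "real D > 0" using cD c0 by linarith
    have "real n \<le> real D ^ 3" unfolding c3[symmetric] using cD c0 by (intro power_mono) auto
    then have "n \<le> D ^ 3" by (metis of_nat_le_iff of_nat_power)
    then have aD: "card A \<le> D ^ 3" using n(1) by simp
    have "D \<ge> 1729" using cD c1 by linarith
    from card_large_degree_le[OF assms(1-4) this aD]
    have "real (b D) * real D ^ 2 \<le> 2400000 * real (card A) * sqrt (real (card A) * real D)"
      unfolding b_def .
    also have "\<dots> \<le> 2400000 * real n * sqrt (real n * real D)"
      using n(1) by (intro mult_mono real_sqrt_le_mono mult_right_mono) auto
    also have "\<dots> = (2400000 * real n * sqrt (real n) * (1 / (real D * sqrt (real D)))) * real D ^ 2"
    proof -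
      have e: "sqrt (real D) = 1 / (real D * sqrt (real D)) * real D ^ 2"
        using D0 by (simp add: field_simps power2_eq_square)
      have "2400000 * real n * sqrt (real n * real D) = 2400000 * real n * sqrt (real n) * sqrt (real D)"
        by (simp add: real_sqrt_mult)
      also have "\<dots> = 2400000 * real n * sqrt (real n) * (1 / (real D * sqrt (real D)) * real D ^ 2)"
        using e by (rule arg_cong)
      finally show ?thesis by (simp only: mult.assoc)
    qed
    finally show "real (b D) \<le> 2400000 * real n * sqrt (real n) * (1 / (real D * sqrt (real D)))"
      by (rule mult_right_le_imp_le) (use D0 in simp)
  qed
  also have "\<dots> = 2400000 * real n * sqrt (real n) * (\<Sum>D\<in>{K<..n}. 1 / (real D * sqrt (real D)))"
    by (simp only: sum_distrib_left)
  also have "\<dots> \<le> 2400000 * real n * sqrt (real n) * (2 / sqrt c)"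
  proof (rule mult_left_mono)
    have "(\<Sum>D\<in>{K<..n}. 1 / (real D * sqrt (real D))) \<le> 2 / sqrt (real K) - 2 / sqrt (real n)"
      by (rule sum_inverse_power32_le[OF K(3) Kn])
    also have "\<dots> \<le> 2 / sqrt (real K)" by simp
    also have "\<dots> \<le> 2 / sqrt c" using K(1) c0 by (intro divide_left_mono) auto
    finally show "(\<Sum>D\<in>{K<..n}. 1 / (real D * sqrt (real D))) \<le> 2 / sqrt c" .
  qed simp
  also have "\<dots> = 4800000 * c ^ 4"
  proof -
    have "real n = c\<^sup>2 * c" by (simp add: c3[symmetric] power_numeral_reduce)
    then have "sqrt (real n) = c * sqrt c" using c0 by (simp add: real_sqrt_mult)
    then have "sqrt (real n) * (2 / sqrt c) = 2 * c" using c0 by simp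
    then have "2400000 * real n * sqrt (real n) * (2 / sqrt c) = 2400000 * real n * (2 * c)"
      by (simp only: mult.assoc)
    then show ?thesis by (simp add: c3[symmetric] power_numeral_reduce)
  qed
  finally show ?thesis unfolding c4 by simp
qed

text \<open>Adding the vertices one at a time, each goes to the side with fewer of its earlier
  neighbours, so at least half of the new edges are cut. The cut is counted by degrees from
  \<open>V - A\<close> into \<open>A\<close>, the form that \<open>sum_degree_le\<close>
  bounds.\<close>

lemma max_cut:
  assumes "finite V" "\<And>e. e \<in> E \<Longrightarrow> e \<subseteq> V \<and> card e = 2"
  shows "\<exists>A\<subseteq>V. card E \<le> 2 * (\<Sum>w\<in>V - A. card {a \<in> A. {a, w} \<in> E})"
  using assms
proof (induction V arbitrary: E rule: finite_induct)
  case empty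
  then have "E = {}" by force
  then show ?case by simp
next
  case (insert x V)
  define E' where "E' = {e \<in> E. x \<notin> e}"
  have finE: "finite E" using insert.prems insert.hyps(1)
    by (intro finite_subset[of E "Pow (insert x V)"]) auto
  obtain A where A: "A \<subseteq> V" "card E' \<le> 2 * (\<Sum>w\<in>V - A. card {a \<in> A. {a, w} \<in> E'})"
    using insert.IH[of E'] insert.prems unfolding E'_def by blast
  have finA: "finite A" using A(1) insert.hyps(1) finite_subset by blast
  have xA: "x \<notin> A" using A(1) insert.hyps(2) by blast
  have old: "{a \<in> A. {a, w} \<in> E'} = {a \<in> A. {a, w} \<in> E}" if "w \<in> V - A" for w
    using that A(1) insert.hyps(2) by (auto simp: E'_def)
  define S where "S = (\<Sum>w\<in>V - A. card {a \<in> A. {a, w} \<in> E})"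
  have S: "card E' \<le> 2 * S" using A(2) old by (simp add: S_def)
  define p where "p = card {v \<in> A. {v, x} \<in> E}"
  define r where "r = card {v \<in> V - A. {x, v} \<in> E}"
  have cE: "card E \<le> card E' + (p + r)"
  proof -
    have "E \<subseteq> E' \<union> ((\<lambda>v. {v, x}) ` {v \<in> A. {v, x} \<in> E} \<union> (\<lambda>v. {x, v}) ` {v \<in> V - A. {x, v} \<in> E})"
    proof
      fix e assume e: "e \<in> E"
      show "e \<in> E' \<union> ((\<lambda>v. {v, x}) ` {v \<in> A. {v, x} \<in> E} \<union> (\<lambda>v. {x, v}) ` {v \<in> V - A. {x, v} \<in> E})"
      proof (cases "x \<in> e")
        case True
        obtain a b where "e = {a, b}" "a \<noteq> b" using insert.prems[OF e] by (auto simp: card_2_iff)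
        then obtain v where v: "e = {x, v}" "v \<noteq> x" using True by blast
        then have "v \<in> V" using insert.prems[OF e] by auto
        then show ?thesis using v e by (cases "v \<in> A") (auto simp: insert_commute)
      qed (use e in \<open>simp add: E'_def\<close>)
    qed
    then have "card E \<le> card (E' \<union> ((\<lambda>v. {v, x}) ` {v \<in> A. {v, x} \<in> E} \<union> (\<lambda>v. {x, v}) ` {v \<in> V - A. {x, v} \<in> E}))"
      using finE finA insert.hyps(1) by (intro card_mono) (auto simp: E'_def)
    also have "\<dots> \<le> card E' + (p + r)" unfolding p_def r_def
      using finA insert.hyps(1)
      by (intro order_trans[OF card_Un_le] add_mono card_image_le order_refl) auto
    finally show ?thesis .
  qed
  show ?case
  proof (cases "r \<le> p")
    case True
    have "insert x V - A = insert x (V - A)" using xA by auto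
    then have "(\<Sum>w\<in>insert x V - A. card {a \<in> A. {a, w} \<in> E}) = p + S"
      using insert.hyps by (simp add: S_def p_def)
    then have "card E \<le> 2 * (\<Sum>w\<in>insert x V - A. card {a \<in> A. {a, w} \<in> E})"
      using S cE True by linarith
    then show ?thesis using A(1) by blast
  next
    case False
    have "insert x V - insert x A = V - A" using insert.hyps(2) by auto
    moreover have "card {a \<in> insert x A. {a, w} \<in> E} = card {a \<in> A. {a, w} \<in> E} + of_bool ({x, w} \<in> E)" for w
    proof -
      have "{a \<in> insert x A. {a, w} \<in> E} = {a \<in> A. {a, w} \<in> E} \<union> (if {x, w} \<in> E then {x} else {})" by auto
      then show ?thesis using xA finA by simp
    qed
    ultimately have "(\<Sum>w\<in>insert x V - insert x A. card {a \<in> insert x A. {a, w} \<in> E}) = S + r"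
      using insert.hyps(1) by (simp add: S_def r_def sum.distrib sum_of_bool_eq Int_def)
    then have "card E \<le> 2 * (\<Sum>w\<in>insert x V - insert x A. card {a \<in> insert x A. {a, w} \<in> E})"
      using S cE False by linarith
    then show ?thesis using A(1) by (intro exI[of _ "insert x A"]) auto
  qed
qed

text \<open>The degree bound is applied to a bipartite subgraph of an extremal graph that keeps at
  least half of the edges, which doubles the constant 4800002.\<close>

lemma turan_number_upper_bound:
  assumes "1729 ^ 3 \<le> n"
  shows "real (turan_number n (one_subdivision (complete_bipartite 3 25))) \<le> 9600004 * real n powr (4 / 3)"
proof -
  let ?H = "one_subdivision (complete_bipartite 3 25)"
  have "simple_graph ?H" by (intro simple_graph_one_subdivision simple_graph_complete_bipartite)
  moreover have "edges ?H \<noteq> {}"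
  proof -
    have "{Inl 0, Inr 0} \<in> edges (complete_bipartite 3 25)"
      unfolding complete_bipartite_def by force
    then show ?thesis unfolding one_subdivision_def by auto
  qed
  ultimately have "turan_number n ?H \<in> turan_set n ?H"
    unfolding turan_number_def by (intro Max_in turan_set_finite turan_set_nonempty)
  then obtain G :: "nat ugraph" where G: "turan_number n ?H = card (edges G)" "simple_graph G"
    "card (verts G) = n" "\<not> contains_copy G ?H"
    by (auto simp: turan_set_def)
  have finV: "finite (verts G)" and E: "\<And>e. e \<in> edges G \<Longrightarrow> e \<subseteq> verts G \<and> card e = 2"
    using G(2) by (auto simp: simple_graph_def)
  obtain A where A: "A \<subseteq> verts G"
    "card (edges G) \<le> 2 * (\<Sum>w\<in>verts G - A. card {a \<in> A. {a, w} \<in> edges G})"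
    using max_cut[OF finV E] by blast
  have "(\<Sum>w\<in>verts G - A. real (card {a \<in> A. {a, w} \<in> edges G})) \<le> 4800002 * real n powr (4 / 3)"
  proof (rule sum_degree_le)
    show "finite A" "finite (verts G - A)" using A(1) finV finite_subset by auto
    show "card A \<le> n" "card (verts G - A) \<le> n"
      using card_mono[OF finV A(1)] card_mono[OF finV, of "verts G - A"] G(3) by auto
    show "\<not> family_biclique (verts G - A) (\<lambda>w. {a \<in> A. {a, w} \<in> edges G}) x u y" for x u y
    proof
      assume f: "family_biclique (verts G - A) (\<lambda>w. {a \<in> A. {a, w} \<in> edges G}) x u y"
      \<comment> \<open>Branch vertices lie in \<open>A\<close> and middle vertices outside it, so
        the two kinds are disjoint.\<close>
      have y: "y i j \<notin> A" "x i \<in> A" "u j \<in> A" "{x i, y i j} \<in> edges G" "{u j, y i j} \<in> edges G"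
        if "i < 3" "j < 25" for i j
        using f that unfolding family_biclique_def by auto
      have xA: "x i \<in> A" if "i < 3" for i using y(2)[OF that, of 0] by simp
      have uA: "u j \<in> A" if "j < 25" for j using y(3)[OF _ that, of 0] by simp
      have "subdivided_biclique 3 25 (edges G) x u y"
        unfolding subdivided_biclique_def
      proof (intro conjI)
        show "\<forall>k<3. \<forall>i<3. \<forall>j<25. x k \<noteq> y i j" using xA y(1) by metis
        show "\<forall>k<25. \<forall>i<3. \<forall>j<25. u k \<noteq> y i j" using uA y(1) by metis
        show "\<forall>i<3. \<forall>j<25. {x i, y i j} \<in> edges G \<and> {u j, y i j} \<in> edges G" using y(4,5) by blast
      qed (use f in \<open>auto simp: family_biclique_def\<close>)
      then show False using G(4) contains_subdivided_biclique_iff[OF G(2), of 3 25] by auto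
    qed
  qed (use assms in auto)
  moreover have "real (card (edges G)) \<le> real (2 * (\<Sum>w\<in>verts G - A. card {a \<in> A. {a, w} \<in> edges G}))"
    using A(2) by (simp only: of_nat_le_iff)
  ultimately show ?thesis unfolding G(1) by simp
qed

theorem theorem1p1:
  shows "\<exists>c C :: real. c > 0 \<and> C > 0 \<and>
    (\<forall>\<^sub>F n in sequentially.
       c * real n powr (4 / 3) \<le> real (turan_number n (one_subdivision (complete_bipartite 3 25))) \<and>
       real (turan_number n (one_subdivision (complete_bipartite 3 25))) \<le> C * real n powr (4 / 3))"
proof (intro exI conjI)
  show "\<forall>\<^sub>F n in sequentially.
       1 / 729 * real n powr (4 / 3) \<le> real (turan_number n (one_subdivision (complete_bipartite 3 25))) \<and>
       real (turan_number n (one_subdivision (complete_bipartite 3 25))) \<le> 9600004 * real n powr (4 / 3)"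
    using eventually_ge_at_top[of "1729 ^ 3 :: nat"]
  proof eventually_elim
    case (elim n)
    then show ?case using turan_number_lower_bound[of n] turan_number_upper_bound[of n] by auto
  qed
qed simp_all

end
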